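(* Let $n\in\mathbb Z$. The persistent homology functor $P_n:\mathcal F\to\mathcal P$ factors as $\mathcal F\to\operatorname{coim}P_n\xrightarrow{\Phi}\operatorname{im}P_n\hookrightarrow\mathcal P$, where $\mathcal F\to\operatorname{coim}P_n$ is the quotient functor and $\Phi$ is defined by $\Phi(X)=P_n(X)$ on objects and $\Phi([f])=P_n(f)$ on morphisms; and $\Phi$ is an equivalence of categories.
   Context: Fix a field $\mathbb F$; all vector spaces are finite-dimensional over $\mathbb F$. A complex is a family $(V_n,\partial_n)_{n\in\mathbb Z}$ with $\partial_n:V_n\to V_{n-1}$, $\partial_{n-1}\partial_n=0$, all but finitely many $\partial_n$ isomorphisms; morphisms are chain maps. A filtered complex is a family of complexes $({}_pV_\bullet)_{p\in\mathbb Z}$ with each ${}_pV_\bullet$ a subcomplex of ${}_{p+1}V_\bullet$, ${}_pV_\bullet=0$ for $p$ sufficiently small, and ${}_pV_\bullet={}_{p+1}V_\bullet$ for all but finitely many $p$; morphisms are families of chain maps commuting with the inclusions. $\mathcal F$ is the category of filtered complexes. A persistence vector space is a diagram $(W_p\to W_{p+1})_{p\in\mathbb Z}$ of vector spaces, morphisms being families of linear maps commuting with arrows; it is tempered if all but finitely many arrows are isomorphisms, and bounded below if $W_p=0$ for all sufficiently small $p$. $\mathcal P$ is the category of tempered persistence vector spaces and $\operatorname{im}P_n$ its full subcategory of those bounded below. $P_n$ sends a filtered complex to $(H_n({}_pV_\bullet)\to H_n({}_{p+1}V_\bullet))_p$ (maps induced by inclusions; $H_n$ is degree-$n$ homology)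 and acts on morphisms via $H_n$. The quotient category $\operatorname{coim}P_n$ has the same objects as $\mathcal F$, and its morphisms are equivalence classes $[f]$ of morphisms of $\mathcal F$ under the congruence $f\sim f'$ iff $P_n(f)=P_n(f')$. *)

theory Defs
  imports Main
begin

text \<open>A vector space over the field 'k (a type of class field) is given by a
carrier set together with addition, zero and scalar multiplication.
Explicit structures are needed because homology spaces are quotients.\<close>

record ('k, 'v) vs =
  vcarrier :: "'v set"
  vadd :: "'v \<Rightarrow> 'v \<Rightarrow> 'v"
  vzero :: "'v"
  vscale :: "'k \<Rightarrow> 'v \<Rightarrow> 'v"

definition vs_axioms :: "('k::field, 'v) vs \<Rightarrow> bool" where
  "vs_axioms V \<longleftrightarrow>
     vzero V \<in> vcarrier V \<and>
     (\<forall>x\<in>vcarrier V. \<forall>y\<in>vcarrier V. vadd V x y \<in> vcarrier V) \<and>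
     (\<forall>c. \<forall>x\<in>vcarrier V. vscale V c x \<in> vcarrier V) \<and>
     (\<forall>x\<in>vcarrier V. \<forall>y\<in>vcarrier V. \<forall>z\<in>vcarrier V.
        vadd V (vadd V x y) z = vadd V x (vadd V y z)) \<and>
     (\<forall>x\<in>vcarrier V. \<forall>y\<in>vcarrier V. vadd V x y = vadd V y x) \<and>
     (\<forall>x\<in>vcarrier V. vadd V (vzero V) x = x) \<and>
     (\<forall>x\<in>vcarrier V. \<exists>y\<in>vcarrier V. vadd V x y = vzero V) \<and>
     (\<forall>c. \<forall>x\<in>vcarrier V. \<forall>y\<in>vcarrier V.
        vscale V c (vadd V x y) = vadd V (vscale V c x) (vscale V c y)) \<and>
     (\<forall>a b. \<forall>x\<in>vcarrier V. vscale V (a + b) x = vadd V (vscale V a x) (vscale V b x)) \<and>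
     (\<forall>a b. \<forall>x\<in>vcarrier V. vscale V (a * b) x = vscale V a (vscale V b x)) \<and>
     (\<forall>x\<in>vcarrier V. vscale V 1 x = x)"

definition lincomb :: "('k, 'v) vs \<Rightarrow> 'k list \<Rightarrow> 'v list \<Rightarrow> 'v" where
  "lincomb V cs bs = foldr (\<lambda>(c, b) acc. vadd V (vscale V c b) acc) (zip cs bs) (vzero V)"

definition fin_dim :: "('k, 'v) vs \<Rightarrow> bool" where
  "fin_dim V \<longleftrightarrow> (\<exists>bs. set bs \<subseteq> vcarrier V \<and>
      (\<forall>x\<in>vcarrier V. \<exists>cs. length cs = length bs \<and> x = lincomb V cs bs))"

definition fdvs :: "('k::field, 'v) vs \<Rightarrow> bool" where
  "fdvs V \<longleftrightarrow> vs_axioms V \<and> fin_dim V"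

definition restr :: "('k, 'v) vs \<Rightarrow> 'v set \<Rightarrow> ('k, 'v) vs" where
  "restr V S = V\<lparr>vcarrier := S\<rparr>"

definition vs_subspace :: "('k, 'v) vs \<Rightarrow> 'v set \<Rightarrow> bool" where
  "vs_subspace V S \<longleftrightarrow> S \<subseteq> vcarrier V \<and> vzero V \<in> S \<and>
     (\<forall>x\<in>S. \<forall>y\<in>S. vadd V x y \<in> S) \<and> (\<forall>c. \<forall>x\<in>S. vscale V c x \<in> S)"

definition vs_linear :: "('k, 'v) vs \<Rightarrow> ('k, 'w) vs \<Rightarrow> ('v \<Rightarrow> 'w) \<Rightarrow> bool" where
  "vs_linear V W f \<longleftrightarrow>
     (\<forall>x\<in>vcarrier V. f x \<in> vcarrier W) \<and>
     (\<forall>x\<in>vcarrier V. \<forall>y\<in>vcarrier V. f (vadd V x y) = vadd W (f x) (f y)) \<and>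
     (\<forall>c. \<forall>x\<in>vcarrier V. f (vscale V c x) = vscale W c (f x))"

definition coset :: "('k, 'v) vs \<Rightarrow> 'v set \<Rightarrow> 'v \<Rightarrow> 'v set" where
  "coset V B x = {vadd V x b | b. b \<in> B}"

definition rep :: "'v set \<Rightarrow> 'v" where
  "rep A = (SOME a. a \<in> A)"

definition quot :: "('k, 'v) vs \<Rightarrow> 'v set \<Rightarrow> 'v set \<Rightarrow> ('k, 'v set) vs" where
  "quot V Z B = \<lparr> vcarrier = coset V B ` Z,
                  vadd = (\<lambda>A A'. coset V B (vadd V (rep A) (rep A'))),
                  vzero = coset V B (vzero V),
                  vscale = (\<lambda>c A. coset V B (vscale V c (rep A))) \<rparr>"

definition qmap :: "('k, 'w) vs \<Rightarrow> 'w set \<Rightarrow> ('v \<Rightarrow> 'w) \<Rightarrow> 'v set \<Rightarrow> 'w set" where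
  "qmap W B' g A = coset W B' (g (rep A))"

text \<open>A filtered complex: for each degree n an ambient structure fmod n
(supplying the vector space operations), the subspaces fsub p n = {}_pV_n,
and the boundary maps fbd n : V_n \<rightarrow> V_(n-1), shared by all filtration levels
(so that each {}_pV is a subcomplex of {}_(p+1)V).\<close>

record ('k, 'v) fcomplex =
  fmod :: "int \<Rightarrow> ('k, 'v) vs"
  fsub :: "int \<Rightarrow> int \<Rightarrow> 'v set"
  fbd :: "int \<Rightarrow> 'v \<Rightarrow> 'v"

definition lvl :: "('k, 'v) fcomplex \<Rightarrow> int \<Rightarrow> int \<Rightarrow> ('k, 'v) vs" where
  "lvl X p n = restr (fmod X n) (fsub X p n)"

definition is_fc :: "('k::field, 'v) fcomplex \<Rightarrow> bool" where
  "is_fc X \<longleftrightarrow>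
     (\<forall>n. vs_axioms (fmod X n)) \<and>
     (\<forall>p n. vs_subspace (fmod X n) (fsub X p n) \<and> fin_dim (lvl X p n)) \<and>
     (\<forall>p n. vs_linear (lvl X p n) (lvl X p (n - 1)) (fbd X n)) \<and>
     (\<forall>p n. \<forall>x\<in>fsub X p n. fbd X (n - 1) (fbd X n x) = vzero (fmod X (n - 2))) \<and>
     (\<forall>p. finite {n. \<not> bij_betw (fbd X n) (fsub X p n) (fsub X p (n - 1))}) \<and>
     (\<forall>p n. fsub X p n \<subseteq> fsub X (p + 1) n) \<and>
     (\<exists>p0. \<forall>p\<le>p0. \<forall>n. fsub X p n = {vzero (fmod X n)}) \<and>
     finite {p. fsub X p \<noteq> fsub X (p + 1)}"

definition fc_mor :: "('k, 'v) fcomplex \<Rightarrow> ('k, 'u) fcomplex \<Rightarrow>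
    (int \<Rightarrow> int \<Rightarrow> 'v \<Rightarrow> 'u) \<Rightarrow> bool" where
  "fc_mor X Y f \<longleftrightarrow>
     (\<forall>p n. vs_linear (lvl X p n) (lvl Y p n) (f p n)) \<and>
     (\<forall>p n. \<forall>x\<in>fsub X p n. f p (n - 1) (fbd X n x) = fbd Y n (f p n x)) \<and>
     (\<forall>p n. \<forall>x\<in>fsub X p n. f (p + 1) n x = f p n x)"

record ('k, 'w) pvs =
  pspace :: "int \<Rightarrow> ('k, 'w) vs"
  parr :: "int \<Rightarrow> 'w \<Rightarrow> 'w"

definition is_pvs :: "('k::field, 'w) pvs \<Rightarrow> bool" where
  "is_pvs W \<longleftrightarrow> (\<forall>p. fdvs (pspace W p)) \<and>
     (\<forall>p. vs_linear (pspace W p) (pspace W (p + 1)) (parr W p))"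

definition tempered :: "('k, 'w) pvs \<Rightarrow> bool" where
  "tempered W \<longleftrightarrow>
     finite {p. \<not> bij_betw (parr W p) (vcarrier (pspace W p)) (vcarrier (pspace W (p + 1)))}"

definition bounded_below :: "('k, 'w) pvs \<Rightarrow> bool" where
  "bounded_below W \<longleftrightarrow> (\<exists>p0. \<forall>p\<le>p0. vcarrier (pspace W p) = {vzero (pspace W p)})"

text \<open>Objects of the category P (tempered) and of its full subcategory im P_n.\<close>
definition obj_P :: "('k::field, 'w) pvs \<Rightarrow> bool" where
  "obj_P W \<longleftrightarrow> is_pvs W \<and> tempered W"

definition obj_imP :: "('k::field, 'w) pvs \<Rightarrow> bool" where
  "obj_imP W \<longleftrightarrow> obj_P W \<and> bounded_below W"

definition pvs_mor :: "('k, 'w) pvs \<Rightarrow> ('k, 'u) pvs \<Rightarrow> (int \<Rightarrow> 'w \<Rightarrow> 'u) \<Rightarrow> bool" where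
  "pvs_mor W W' g \<longleftrightarrow>
     (\<forall>p. vs_linear (pspace W p) (pspace W' p) (g p)) \<and>
     (\<forall>p. \<forall>x\<in>vcarrier (pspace W p). g (p + 1) (parr W p x) = parr W' p (g p x))"

definition pvs_mor_eq :: "('k, 'w) pvs \<Rightarrow> (int \<Rightarrow> 'w \<Rightarrow> 'u) \<Rightarrow> (int \<Rightarrow> 'w \<Rightarrow> 'u) \<Rightarrow> bool" where
  "pvs_mor_eq W g h \<longleftrightarrow> (\<forall>p. \<forall>x\<in>vcarrier (pspace W p). g p x = h p x)"

definition pvs_iso :: "('k, 'w) pvs \<Rightarrow> ('k, 'u) pvs \<Rightarrow> bool" where
  "pvs_iso W W' \<longleftrightarrow> (\<exists>g h. pvs_mor W W' g \<and> pvs_mor W' W h \<and>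
     pvs_mor_eq W (\<lambda>p x. h p (g p x)) (\<lambda>p x. x) \<and>
     pvs_mor_eq W' (\<lambda>p x. g p (h p x)) (\<lambda>p x. x))"

definition cycles :: "('k, 'v) fcomplex \<Rightarrow> int \<Rightarrow> int \<Rightarrow> 'v set" where
  "cycles X p n = {x \<in> fsub X p n. fbd X n x = vzero (fmod X (n - 1))}"

definition boundaries :: "('k, 'v) fcomplex \<Rightarrow> int \<Rightarrow> int \<Rightarrow> 'v set" where
  "boundaries X p n = fbd X (n + 1) ` fsub X p (n + 1)"

definition homology :: "('k, 'v) fcomplex \<Rightarrow> int \<Rightarrow> int \<Rightarrow> ('k, 'v set) vs" where
  "homology X n p = quot (fmod X n) (cycles X p n) (boundaries X p n)"

definition PH_obj :: "int \<Rightarrow> ('k, 'v) fcomplex \<Rightarrow> ('k, 'v set) pvs" where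
  "PH_obj n X = \<lparr> pspace = homology X n,
                  parr = (\<lambda>p. qmap (fmod X n) (boundaries X (p + 1) n) id) \<rparr>"

definition PH_mor :: "int \<Rightarrow> ('k, 'u) fcomplex \<Rightarrow> (int \<Rightarrow> int \<Rightarrow> 'v \<Rightarrow> 'u) \<Rightarrow> int \<Rightarrow> 'v set \<Rightarrow> 'u set" where
  "PH_mor n Y f = (\<lambda>p. qmap (fmod Y n) (boundaries Y p n) (f p n))"

definition coim_rel :: "int \<Rightarrow> ('k, 'v) fcomplex \<Rightarrow> ('k, 'u) fcomplex \<Rightarrow>
    (int \<Rightarrow> int \<Rightarrow> 'v \<Rightarrow> 'u) \<Rightarrow> (int \<Rightarrow> int \<Rightarrow> 'v \<Rightarrow> 'u) \<Rightarrow> bool" where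
  "coim_rel n X Y f f' \<longleftrightarrow> pvs_mor_eq (PH_obj n X) (PH_mor n Y f) (PH_mor n Y f')"

end

theory Submission
  imports Defs
begin

text \<open>Over a field, a filtered family of total linear relations that grows with the filtration has a
filtration-preserving linear selection, because a selection on one level extends to the next.
Fullness follows by applying this three times: to lift a map on homology to cycles, to split the
boundary map, and to lift the restriction to boundaries through the boundary map.  Essential
surjectivity needs only compatible presentations \<open>W p = F p / K p\<close>, regarded as two-term
complexes.  Faithfulness holds by construction of the quotient category.\<close>

section \<open>Vector spaces and finite dimension\<close>

text \<open>A morphism of filtered complexes must commute with the inclusions, so chains cannot be
  chosen independently on each level. Every choice asks only for some \<open>y\<close> in a coset of
  a subspace, and a constraint met at level \<open>p\<close> is still met at \<open>p + 1\<close>.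
  Earlier choices are therefore never revised: over a field it is enough to choose values on a
  complement of \<open>T p\<close> in \<open>T (p + 1)\<close>, starting where the filtration is
  zero. Because all levels share one ambient space, the result is a single function that does not
  depend on \<open>p\<close>, and commuting with the inclusions is automatic.

  For realization the obstacle is that arrows of \<open>W\<close> may fail to be injective, whereas
  inclusions are injective. A class can die only by becoming a boundary, so the relations among the
  generators are placed in degree \<open>n + 1\<close> and grow with \<open>p\<close>; new classes
  enter as new generators. Temperedness confines both kinds of growth to finitely many
  \<open>p\<close>, as a filtered complex demands.\<close>

lemma restr_simps [simp]:
  "vcarrier (restr V S) = S" "vadd (restr V S) = vadd V"
  "vzero (restr V S) = vzero V" "vscale (restr V S) = vscale V"
  by (simp_all add: restr_def)

lemma lincomb_Nil [simp]: "lincomb V cs [] = vzero V"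
  by (simp add: lincomb_def)

lemma lincomb_Cons [simp]:
  "lincomb V (c # cs) (b # bs) = vadd V (vscale V c b) (lincomb V cs bs)"
  by (simp add: lincomb_def)

lemma lincomb_restr [simp]: "lincomb (restr V S) = lincomb V"
  by (simp add: lincomb_def fun_eq_iff)

definition lin_span :: "('k, 'v) vs \<Rightarrow> 'v list \<Rightarrow> 'v set" where
  "lin_span V bs = {lincomb V cs bs | cs. length cs = length bs}"

lemma fin_dim_iff: "fin_dim V \<longleftrightarrow> (\<exists>bs. set bs \<subseteq> vcarrier V \<and> vcarrier V \<subseteq> lin_span V bs)"
  unfolding fin_dim_def lin_span_def by blast

lemma lin_span_restr [simp]: "lin_span (restr V S) = lin_span V"
  by (simp add: lin_span_def fun_eq_iff)

lemma lin_span_Nil [simp]: "lin_span V [] = {vzero V}"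
  by (auto simp: lin_span_def)

lemma lin_span_Cons:
  "lin_span V (b # bs) = {vadd V (vscale V c b) y | c y. y \<in> lin_span V bs}"
proof (intro equalityI subsetI)
  fix x assume "x \<in> lin_span V (b # bs)"
  then obtain cs where "x = lincomb V cs (b # bs)" "length cs = length (b # bs)"
    unfolding lin_span_def by auto
  then show "x \<in> {vadd V (vscale V c b) y | c y. y \<in> lin_span V bs}"
    by (cases cs) (auto simp: lin_span_def)
next
  fix x assume "x \<in> {vadd V (vscale V c b) y | c y. y \<in> lin_span V bs}"
  then obtain c cs where "x = lincomb V (c # cs) (b # bs)" "length (c # cs) = length (b # bs)"
    unfolding lin_span_def by auto
  then show "x \<in> lin_span V (b # bs)"
    unfolding lin_span_def by blast
qed

locale vspace =
  fixes V :: "('k::field, 'v) vs"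
  assumes vs_ax: "vs_axioms V"
begin

lemma
  shows zero_closed [simp]: "vzero V \<in> vcarrier V"
    and add_closed [simp]: "\<lbrakk>x \<in> vcarrier V; y \<in> vcarrier V\<rbrakk> \<Longrightarrow> vadd V x y \<in> vcarrier V"
    and scale_closed [simp]: "x \<in> vcarrier V \<Longrightarrow> vscale V c x \<in> vcarrier V"
    and add_assoc: "\<lbrakk>x \<in> vcarrier V; y \<in> vcarrier V; z \<in> vcarrier V\<rbrakk>
      \<Longrightarrow> vadd V (vadd V x y) z = vadd V x (vadd V y z)"
    and add_commute: "\<lbrakk>x \<in> vcarrier V; y \<in> vcarrier V\<rbrakk> \<Longrightarrow> vadd V x y = vadd V y x"
    and zero_left [simp]: "x \<in> vcarrier V \<Longrightarrow> vadd V (vzero V) x = x"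
    and scale_add: "\<lbrakk>x \<in> vcarrier V; y \<in> vcarrier V\<rbrakk>
      \<Longrightarrow> vscale V c (vadd V x y) = vadd V (vscale V c x) (vscale V c y)"
    and add_scale: "x \<in> vcarrier V \<Longrightarrow> vscale V (a + b) x = vadd V (vscale V a x) (vscale V b x)"
    and scale_scale [simp]: "x \<in> vcarrier V \<Longrightarrow> vscale V a (vscale V b x) = vscale V (a * b) x"
    and scale_one [simp]: "x \<in> vcarrier V \<Longrightarrow> vscale V 1 x = x"
  using vs_ax unfolding vs_axioms_def by auto

lemma zero_right [simp]: "x \<in> vcarrier V \<Longrightarrow> vadd V x (vzero V) = x"
  using add_commute zero_left by simp

lemma add_left_commute: "\<lbrakk>x \<in> vcarrier V; y \<in> vcarrier V; z \<in> vcarrier V\<rbrakk>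
    \<Longrightarrow> vadd V x (vadd V y z) = vadd V y (vadd V x z)"
  by (metis add_assoc add_commute)

lemmas add_ac = add_assoc add_commute add_left_commute

lemma scale_zero_left [simp]: assumes "x \<in> vcarrier V" shows "vscale V 0 x = vzero V"
proof -
  let ?y = "vscale V 0 x"
  have y: "?y \<in> vcarrier V" "vadd V ?y ?y = ?y"
    using assms add_scale[of x 0 0] by auto
  moreover obtain z where "z \<in> vcarrier V" "vadd V ?y z = vzero V"
    using y vs_ax unfolding vs_axioms_def by meson
  ultimately show ?thesis by (metis add_assoc zero_right)
qed

lemma scale_zero_right [simp]: "vscale V c (vzero V) = vzero V"
  by (metis mult_zero_right scale_scale scale_zero_left zero_closed)

lemma add_neg [simp]: "x \<in> vcarrier V \<Longrightarrow> vadd V x (vscale V (-1) x) = vzero V"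
  by (metis add.right_inverse add_scale scale_one scale_zero_left)

lemma add_neg_left [simp]:
  "\<lbrakk>x \<in> vcarrier V; y \<in> vcarrier V\<rbrakk> \<Longrightarrow> vadd V x (vadd V (vscale V (-1) x) y) = y"
  by (metis add_assoc add_neg scale_closed zero_left)

lemma neg_add_left [simp]:
  "\<lbrakk>x \<in> vcarrier V; y \<in> vcarrier V\<rbrakk> \<Longrightarrow> vadd V (vscale V (-1) x) (vadd V x y) = y"
  by (metis add_left_commute add_neg_left scale_closed)

lemma add_left_cancel:
  "\<lbrakk>x \<in> vcarrier V; y \<in> vcarrier V; z \<in> vcarrier V\<rbrakk> \<Longrightarrow> vadd V x y = vadd V x z \<longleftrightarrow> y = z"
  by (metis neg_add_left)

lemma subspaceD:
  assumes "vs_subspace V S"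
  shows "S \<subseteq> vcarrier V" "\<And>x. x \<in> S \<Longrightarrow> x \<in> vcarrier V" "vzero V \<in> S"
    "\<And>x y. \<lbrakk>x \<in> S; y \<in> S\<rbrakk> \<Longrightarrow> vadd V x y \<in> S" "\<And>c x. x \<in> S \<Longrightarrow> vscale V c x \<in> S"
  using assms unfolding vs_subspace_def by auto

lemma vs_axioms_restr:
  assumes "vs_subspace V S" shows "vs_axioms (restr V S)"
proof -
  note S = subspaceD[OF assms]
  have "\<exists>y\<in>S. vadd V x y = vzero V" if "x \<in> S" for x
    using that S by (intro bexI[of _ "vscale V (-1) x"]) auto
  then show ?thesis
    unfolding vs_axioms_def
    by (simp add: S add_assoc scale_add add_scale) (use S(2) add_commute in blast)
qed

lemma lincomb_in_subspace:
  assumes S: "vs_subspace V S" and "set bs \<subseteq> S" shows "lincomb V cs bs \<in> S"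
  using assms(2)
proof (induction bs arbitrary: cs)
  case Nil then show ?case using subspaceD(3)[OF S] by simp
next
  case (Cons b bs)
  then show ?case
    \<comment> \<open>A coefficient list that is too short is truncated by \<open>zip\<close>; for
      the empty list the combination is \<open>vzero V\<close>.\<close>
    using subspaceD[OF S] by (cases cs) (auto simp: lincomb_def)
qed

lemma subspace_carrier: "vs_subspace V (vcarrier V)"
  by (auto simp: vs_subspace_def)

lemma subspace_zero: "vs_subspace V {vzero V}"
  by (auto simp: vs_subspace_def)

lemma subspace_Int: "vs_subspace V S \<Longrightarrow> vs_subspace V T \<Longrightarrow> vs_subspace V (S \<inter> T)"
  by (auto simp: vs_subspace_def)

lemma subspace_add_vector:
  assumes S: "vs_subspace V S" and b: "b \<in> vcarrier V"
  shows "vs_subspace V {vadd V (vscale V c b) y | c y. y \<in> S}" (is "vs_subspace V ?T")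
  unfolding vs_subspace_def
proof (intro conjI ballI allI)
  note SD = subspaceD[OF S]
  show "?T \<subseteq> vcarrier V" using b SD by auto
  show "vzero V \<in> ?T"
    using SD b by (auto intro!: exI[of _ 0] exI[of _ "vzero V"])
  fix x assume "x \<in> ?T"
  then obtain c s where x: "x = vadd V (vscale V c b) s" "s \<in> S" by auto
  show "vscale V d x \<in> ?T" for d
    using x SD b by (auto simp: scale_add intro!: exI[of _ "d * c"] exI[of _ "vscale V d s"])
  fix y assume "y \<in> ?T"
  then obtain d t where y: "y = vadd V (vscale V d b) t" "t \<in> S" by auto
  show "vadd V x y \<in> ?T"
    using x y SD b
    by (auto simp: add_scale add_ac intro!: exI[of _ "c + d"] exI[of _ "vadd V s t"])
qed

lemma subspace_lin_span: "set bs \<subseteq> vcarrier V \<Longrightarrow> vs_subspace V (lin_span V bs)"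
  by (induction bs) (auto simp: subspace_zero lin_span_Cons subspace_add_vector)

lemma set_subset_lin_span:
  assumes "set bs \<subseteq> vcarrier V" shows "set bs \<subseteq> lin_span V bs"
  using assms
proof (induction bs)
  case (Cons b bs)
  have "b \<in> lin_span V (b # bs)"
    using Cons subspaceD(3)[OF subspace_lin_span[of bs]]
    by (auto simp: lin_span_Cons intro!: exI[of _ 1] exI[of _ "vzero V"])
  moreover have "x \<in> lin_span V (b # bs)" if "x \<in> set bs" for x
    using Cons that
    by (auto simp: lin_span_Cons intro!: exI[of _ 0] exI[of _ x])
  ultimately show ?case by auto
qed simp

lemma lin_span_subset:
  "vs_subspace V S \<Longrightarrow> set bs \<subseteq> S \<Longrightarrow> lin_span V bs \<subseteq> S"
  by (auto simp: lin_span_def lincomb_in_subspace)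

text \<open>Induction on the generators of the ambient span. The part of \<open>S\<close> inside the
  span of \<open>bs\<close> is handled by the induction hypothesis. If some \<open>s\<close> in
  \<open>S\<close> lies outside, its coefficient at \<open>b\<close> is nonzero, so a multiple of
  \<open>s\<close> moves any element of \<open>S\<close> into that part, and one further generator
  suffices.\<close>

lemma fin_dim_subspace_lin_span:
  assumes "set bs \<subseteq> vcarrier V" "vs_subspace V S" "S \<subseteq> lin_span V bs"
  shows "fin_dim (restr V S)"
  using assms
proof (induction bs arbitrary: S)
  case Nil
  then show ?case unfolding fin_dim_iff by (auto intro!: exI[of _ "[]"])
next
  case (Cons b bs)
  note SD = subspaceD[OF Cons.prems(2)]
  have b: "b \<in> vcarrier V" and bs: "set bs \<subseteq> vcarrier V" using Cons.prems by auto
  note LD = subspaceD[OF subspace_lin_span[OF bs]]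
  let ?S' = "S \<inter> lin_span V bs"
  have S': "vs_subspace V ?S'"
    using Cons.prems subspace_Int subspace_lin_span[OF bs] by blast
  then obtain es where es: "set es \<subseteq> ?S'" "?S' \<subseteq> lin_span V es"
    using Cons.IH[OF bs S'] unfolding fin_dim_iff by auto
  show ?case
  proof (cases "S \<subseteq> ?S'")
    case True
    then show ?thesis using es unfolding fin_dim_iff by auto
  next
    case False
    then obtain s where s: "s \<in> S" "s \<notin> lin_span V bs" by auto
    then obtain c y where sy: "s = vadd V (vscale V c b) y" "y \<in> lin_span V bs"
      using Cons.prems(3) by (auto simp: lin_span_Cons)
    have "c \<noteq> 0" using s sy b LD by auto
    have "x \<in> lin_span V (s # es)" if x: "x \<in> S" for x
    proof -
      obtain d z where xz: "x = vadd V (vscale V d b) z" "z \<in> lin_span V bs"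
        using Cons.prems(3) x by (auto simp: lin_span_Cons)
      \<comment> \<open>The factor \<open>d / c\<close> is the one that cancels the
        \<open>b\<close>-coefficient \<open>d\<close> of \<open>x\<close> against the coefficient
        \<open>c\<close> of \<open>s\<close>.\<close>
      let ?r = "vadd V x (vscale V (- (d / c)) s)"
      have "?r = vadd V (vadd V (vscale V d b) (vscale V (- d) b)) (vadd V z (vscale V (- (d / c)) y))"
        using xz sy b LD(2) \<open>c \<noteq> 0\<close> by (simp add: scale_add add_ac)
      also have "\<dots> = vadd V z (vscale V (- (d / c)) y)"
        using b xz sy LD(2) add_scale[of b d "- d", symmetric] by simp
      finally have "?r \<in> lin_span V bs" using LD xz sy by simp
      moreover have "?r \<in> S" using x s SD by simp
      ultimately have "?r \<in> lin_span V es" using es by blast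
      moreover have "x = vadd V (vscale V (d / c) s) ?r"
        using x s SD add_scale[of s "d / c" "- (d / c)", symmetric] by (simp add: add_left_commute)
      ultimately show ?thesis unfolding lin_span_Cons by blast
    qed
    then show ?thesis using es s unfolding fin_dim_iff by (auto intro!: exI[of _ "s # es"])
  qed
qed

text \<open>The bound is a set \<open>T\<close> rather than the carrier, because the ambient space
  \<open>fmod X m\<close> may be infinite-dimensional; only the levels are known to be
  finite-dimensional.\<close>

lemma fin_dim_subspace:
  assumes "vs_subspace V S" "S \<subseteq> T" "T \<subseteq> vcarrier V" "fin_dim (restr V T)"
  shows "fin_dim (restr V S)"
  using assms fin_dim_subspace_lin_span[of _ S] unfolding fin_dim_iff by fastforce

end

section \<open>Linear maps and quotients\<close>

lemma vs_linearD:
  assumes "vs_linear V W f"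
  shows "\<And>x. x \<in> vcarrier V \<Longrightarrow> f x \<in> vcarrier W"
    "\<And>x y. \<lbrakk>x \<in> vcarrier V; y \<in> vcarrier V\<rbrakk> \<Longrightarrow> f (vadd V x y) = vadd W (f x) (f y)"
    "\<And>c x. x \<in> vcarrier V \<Longrightarrow> f (vscale V c x) = vscale W c (f x)"
  using assms unfolding vs_linear_def by auto

lemma vs_linear_zero:
  assumes "vs_linear V W f" "vs_axioms V" "vs_axioms W" shows "f (vzero V) = vzero W"
proof -
  interpret V: vspace V by (unfold_locales) (rule assms)
  interpret W: vspace W by (unfold_locales) (rule assms)
  show ?thesis
    using vs_linearD(1)[OF assms(1) V.zero_closed] vs_linearD(3)[OF assms(1) V.zero_closed, of 0]
    by simp
qed

lemma vs_linear_comp: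
  "vs_linear U V f \<Longrightarrow> vs_linear V W g \<Longrightarrow> vs_linear U W (\<lambda>x. g (f x))"
  by (simp add: vs_linear_def)

lemma vs_linear_restr:
  assumes "vs_linear (restr V S) (restr W S') f" "T \<subseteq> S" "\<And>x. x \<in> T \<Longrightarrow> f x \<in> T'"
  shows "vs_linear (restr V T) (restr W T') f"
  using assms unfolding vs_linear_def by (simp add: subset_iff)

lemma lincomb_image:
  assumes "vs_axioms V" "vs_linear V W f" "f (vzero V) = vzero W" "set bs \<subseteq> vcarrier V"
  shows "f (lincomb V cs bs) = lincomb W cs (map f bs)"
  using assms(4)
proof (induction bs arbitrary: cs)
  case Nil then show ?case by (simp add: assms)
next
  case (Cons b bs)
  interpret vspace V by (unfold_locales) (rule assms)
  have "lincomb V ds bs \<in> vcarrier V" for ds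
    using Cons by (intro lincomb_in_subspace[OF subspace_carrier]) auto
  with Cons assms show ?case
    by (cases cs) (auto simp: vs_linearD[OF assms(2)] lincomb_def)
qed

text \<open>Each identity in \<open>Q\<close> is the image of one in \<open>V\<close>. Nothing is
  known about \<open>Q\<close> in advance, so preservation of zero has to be a hypothesis. Applied
  to the coset map, this yields the axioms for a quotient without further work with
  \<open>rep\<close>.\<close>

lemma vs_axioms_image:
  assumes V: "vs_axioms V" and lin: "vs_linear V Q f"
    and surj: "f ` vcarrier V = vcarrier Q" and zero: "f (vzero V) = vzero Q"
  shows "vs_axioms Q"
proof -
  interpret vspace V by (unfold_locales) (rule V)
  note L = vs_linearD(2,3)[OF lin, symmetric]
  have "\<exists>y\<in>vcarrier V. f (vadd V x y) = f (vzero V)" if "x \<in> vcarrier V" for x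
    using that by (intro bexI[of _ "vscale V (-1) x"]) auto
  then show ?thesis
    unfolding vs_axioms_def surj[symmetric] zero[symmetric]
    by (simp add: L add_assoc scale_add add_scale) (use add_commute in metis)
qed

lemma fin_dim_image:
  assumes "vs_axioms V" "vs_linear V Q f" "f ` vcarrier V = vcarrier Q"
    and "f (vzero V) = vzero Q" "fin_dim V"
  shows "fin_dim Q"
proof -
  obtain bs where bs: "set bs \<subseteq> vcarrier V"
    "\<forall>x\<in>vcarrier V. \<exists>cs. length cs = length bs \<and> x = lincomb V cs bs"
    using assms(5) unfolding fin_dim_def by auto
  show ?thesis unfolding fin_dim_def
  proof (intro exI[of _ "map f bs"] conjI ballI)
    show "set (map f bs) \<subseteq> vcarrier Q" using bs assms(3) by auto
    fix y assume "y \<in> vcarrier Q"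
    then obtain x where x: "x \<in> vcarrier V" "y = f x" using assms(3) by auto
    then obtain cs where "length cs = length bs" "x = lincomb V cs bs" using bs by auto
    then show "\<exists>cs. length cs = length (map f bs) \<and> y = lincomb Q cs (map f bs)"
      using x lincomb_image[OF assms(1,2,4) bs(1)] by auto
  qed
qed

text \<open>Linearity of a map out of an image can be tested on preimages. This serves both for maps
  out of a quotient and for the inverse in \<open>first_isomorphism\<close>.\<close>

lemma vs_linear_from_image:
  assumes "vs_linear V Q f" "f ` vcarrier V = vcarrier Q"
    and h: "vs_linear V U (\<lambda>x. h (f x))" and "vs_axioms V"
  shows "vs_linear Q U h"
proof -
  interpret vspace V by (unfold_locales) (rule assms)
  note L = vs_linearD(2,3)[OF assms(1), symmetric] and H = vs_linearD[OF h]
  show ?thesis unfolding vs_linear_def assms(2)[symmetric]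
    by (auto simp: L H)
qed

section \<open>Subquotients of an ambient vector space\<close>

locale vs_quotient = vspace V for V :: "('k::field, 'v) vs" +
  fixes Z B :: "'v set"
  assumes subspace_Z: "vs_subspace V Z" and subspace_B: "vs_subspace V B" and B_le_Z: "B \<subseteq> Z"
begin

lemmas ZD = subspaceD[OF subspace_Z]
lemmas BD = subspaceD[OF subspace_B]

lemma coset_add_B:
  assumes "x \<in> vcarrier V" "b \<in> B" shows "coset V B (vadd V x b) = coset V B x"
proof -
  have "\<exists>b''\<in>B. vadd V (vadd V x b) b' = vadd V x b''" if "b' \<in> B" for b'
    using assms that BD by (intro bexI[of _ "vadd V b b'"]) (auto simp: add_assoc)
  moreover have "\<exists>b''\<in>B. vadd V x b' = vadd V (vadd V x b) b''" if "b' \<in> B" for b'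
    using assms that BD
    by (intro bexI[of _ "vadd V (vscale V (-1) b) b'"]) (auto simp: add_assoc)
  ultimately show ?thesis unfolding coset_def by blast
qed

lemma coset_eq_iff:
  assumes "x \<in> vcarrier V" "y \<in> vcarrier V"
  shows "coset V B y = coset V B x \<longleftrightarrow> (\<exists>b\<in>B. y = vadd V x b)"
proof
  assume "coset V B y = coset V B x"
  moreover have "y \<in> coset V B y"
    using assms BD by (auto simp: coset_def intro!: exI[of _ "vzero V"])
  ultimately show "\<exists>b\<in>B. y = vadd V x b" by (auto simp: coset_def)
qed (use assms coset_add_B in auto)

lemma coset_eq_zero_iff:
  "x \<in> vcarrier V \<Longrightarrow> coset V B x = coset V B (vzero V) \<longleftrightarrow> x \<in> B"
  using coset_eq_iff[OF zero_closed, of x] BD(2) by auto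

lemma rep_coset:
  assumes "x \<in> vcarrier V" obtains b where "b \<in> B" "rep (coset V B x) = vadd V x b"
proof -
  have "vadd V x (vzero V) \<in> coset V B x" using BD unfolding coset_def by blast
  then have "rep (coset V B x) \<in> coset V B x" unfolding rep_def by (rule someI)
  then show thesis using that by (auto simp: coset_def)
qed

lemma coset_rep: "x \<in> vcarrier V \<Longrightarrow> coset V B (rep (coset V B x)) = coset V B x"
  by (metis rep_coset coset_add_B)

lemma coset_rep': "A \<in> coset V B ` Z \<Longrightarrow> coset V B (rep A) = A"
  using coset_rep ZD(2) by auto

lemma quot_carrier [simp]: "vcarrier (quot V Z B) = coset V B ` Z"
  and quot_zero [simp]: "vzero (quot V Z B) = coset V B (vzero V)"
  by (simp_all add: quot_def)

lemma linear_coset: "vs_linear (restr V Z) (quot V Z B) (coset V B)"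
  unfolding vs_linear_def
proof (intro conjI ballI allI)
  fix x assume x: "x \<in> vcarrier (restr V Z)"
  then show "coset V B x \<in> vcarrier (quot V Z B)" by auto
  from x have x: "x \<in> vcarrier V" using ZD by auto
  obtain a where a: "a \<in> B" "rep (coset V B x) = vadd V x a" using rep_coset[OF x] .
  show "coset V B (vscale (restr V Z) c x) = vscale (quot V Z B) c (coset V B x)" for c
    using a x BD by (simp add: quot_def scale_add coset_add_B)
  fix y assume "y \<in> vcarrier (restr V Z)"
  then have y: "y \<in> vcarrier V" using ZD by auto
  obtain b where b: "b \<in> B" "rep (coset V B y) = vadd V y b" using rep_coset[OF y] .
  \<comment> \<open>The errors \<open>a\<close> and \<open>b\<close> of the two chosen
    representatives are collected into one element of \<open>B\<close>, which the coset
    absorbs.\<close>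
  have "vadd V (vadd V x a) (vadd V y b) = vadd V (vadd V x y) (vadd V a b)"
    using x y a b BD by (simp add: add_ac)
  then show "coset V B (vadd (restr V Z) x y) = vadd (quot V Z B) (coset V B x) (coset V B y)"
    using a b x y BD by (simp add: quot_def coset_add_B)
qed

lemma vs_axioms_quot: "vs_axioms (quot V Z B)"
  using vs_axioms_image[OF vs_axioms_restr[OF subspace_Z] linear_coset] by simp

lemma fin_dim_quot: "fin_dim (restr V Z) \<Longrightarrow> fin_dim (quot V Z B)"
  using fin_dim_image[OF vs_axioms_restr[OF subspace_Z] linear_coset] by simp

lemma linear_from_quot:
  "vs_linear (restr V Z) U (\<lambda>x. h (coset V B x)) \<Longrightarrow> vs_linear (quot V Z B) U h"
  using vs_linear_from_image[OF linear_coset _ _ vs_axioms_restr[OF subspace_Z]] by simp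

end

text \<open>\<open>qmap\<close> evaluates \<open>g\<close> at the arbitrary representative chosen by
  \<open>rep\<close>. It differs from \<open>x\<close> by an element of \<open>B\<close>, which
  \<open>g\<close> sends into \<open>B'\<close>, so the choice becomes invisible. All later
  computations with induced maps go through this rule.\<close>

lemma qmap_coset:
  assumes "vs_quotient V Z B" "vs_quotient W Z' B'" and g: "vs_linear (restr V Z) (restr W Z') g"
    and B: "\<And>b. b \<in> B \<Longrightarrow> g b \<in> B'" and x: "x \<in> Z"
  shows "qmap W B' g (coset V B x) = coset W B' (g x)"
proof -
  interpret V: vs_quotient V Z B by fact
  interpret W: vs_quotient W Z' B' by fact
  obtain b where b: "b \<in> B" "rep (coset V B x) = vadd V x b"
    using x V.ZD V.rep_coset by metis
  then have "g (rep (coset V B x)) = vadd W (g x) (g b)"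
    using vs_linearD[OF g] x V.B_le_Z by auto
  then show ?thesis
    using W.coset_add_B B b x vs_linearD(1)[OF g] W.ZD(2) by (simp add: qmap_def)
qed

lemma linear_qmap:
  assumes "vs_quotient V Z B" "vs_quotient W Z' B'" and g: "vs_linear (restr V Z) (restr W Z') g"
    and B: "\<And>b. b \<in> B \<Longrightarrow> g b \<in> B'"
  shows "vs_linear (quot V Z B) (quot W Z' B') (qmap W B' g)"
proof -
  interpret V: vs_quotient V Z B by fact
  interpret W: vs_quotient W Z' B' by fact
  have "vs_linear (restr V Z) (quot W Z' B') (\<lambda>x. coset W B' (g x))"
    using vs_linear_comp[OF g W.linear_coset] .
  then have "vs_linear (restr V Z) (quot W Z' B') (\<lambda>x. qmap W B' g (coset V B x))"
    using qmap_coset[OF assms] vspace.subspaceD V.ZD by (simp add: vs_linear_def)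
  then show ?thesis by (rule V.linear_from_quot)
qed

section \<open>Linear selections of linear relations\<close>

text \<open>For a subspace \<open>T\<close>, the graph of \<open>R\<close> over \<open>T\<close> is
  a linear subspace of the product that projects onto \<open>T\<close>. It encodes problems such as
  choosing a preimage, whose solutions form a coset instead of a single vector.\<close>

definition total_linear_rel ::
  "('k, 'v) vs \<Rightarrow> ('k, 'w) vs \<Rightarrow> 'v set \<Rightarrow> ('v \<Rightarrow> 'w \<Rightarrow> bool) \<Rightarrow> bool" where
  "total_linear_rel V W T R \<longleftrightarrow>
     (\<forall>x\<in>T. \<exists>y. R x y) \<and> (\<forall>x\<in>T. \<forall>y. R x y \<longrightarrow> y \<in> vcarrier W) \<and>
     (\<forall>x\<in>T. \<forall>x'\<in>T. \<forall>y y'. R x y \<longrightarrow> R x' y' \<longrightarrow> R (vadd V x x') (vadd W y y')) \<and>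
     (\<forall>c. \<forall>x\<in>T. \<forall>y. R x y \<longrightarrow> R (vscale V c x) (vscale W c y))"

definition linear_selection ::
  "('k, 'v) vs \<Rightarrow> ('k, 'w) vs \<Rightarrow> 'v set \<Rightarrow> ('v \<Rightarrow> 'w \<Rightarrow> bool) \<Rightarrow> ('v \<Rightarrow> 'w) \<Rightarrow> bool" where
  "linear_selection V W T R f \<longleftrightarrow> vs_linear (restr V T) W f \<and> (\<forall>x\<in>T. R x (f x))"

text \<open>Choose any \<open>y\<close> related to \<open>b\<close> and send \<open>c b + s\<close>
  to \<open>c y + f s\<close>. This is well defined because \<open>b\<close> lies outside
  \<open>S\<close>, and it is a selection because \<open>R\<close> is closed under linear
  combinations.\<close>

lemma linear_selection_add_vector:
  assumes V: "vs_axioms V" and W: "vs_axioms W"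
    and T: "vs_subspace V T" and R: "total_linear_rel V W T R"
    and S: "vs_subspace V S" "S \<subseteq> T" and f: "linear_selection V W S R f"
    and b: "b \<in> T" "b \<notin> S"
  shows "\<exists>f'. linear_selection V W {vadd V (vscale V c b) s | c s. s \<in> S} R f' \<and>
    (\<forall>x\<in>S. f' x = f x)"
proof -
  interpret V: vspace V by (unfold_locales) (rule V)
  interpret W: vspace W by (unfold_locales) (rule W)
  note SD = V.subspaceD[OF S(1)] and TD = V.subspaceD[OF T]
  have fl: "\<And>x. x \<in> S \<Longrightarrow> f x \<in> vcarrier W"
    "\<And>x y. \<lbrakk>x \<in> S; y \<in> S\<rbrakk> \<Longrightarrow> f (vadd V x y) = vadd W (f x) (f y)"
    "\<And>c x. x \<in> S \<Longrightarrow> f (vscale V c x) = vscale W c (f x)"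
    and fR: "\<And>x. x \<in> S \<Longrightarrow> R x (f x)"
    using f by (auto simp: linear_selection_def vs_linear_def)
  obtain y where y: "R b y" "y \<in> vcarrier W"
    using R b unfolding total_linear_rel_def by blast
  have bV: "b \<in> vcarrier V" using b TD by auto
  have uniq: "c = d \<and> s = t"
    if "vadd V (vscale V c b) s = vadd V (vscale V d b) t" "s \<in> S" "t \<in> S" for c d s t
  proof -
    \<comment> \<open>Subtracting the two representations puts \<open>vscale V (c - d) b\<close>
      into \<open>S\<close>; if \<open>c \<noteq> d\<close>, dividing by \<open>c - d\<close> would
      put \<open>b\<close> there as well.\<close>
    have "vscale V (c - d) b = vadd V (vscale V (- d) b) (vscale V c b)"
      using bV V.add_scale[of b "- d" c] by simp
    also have "\<dots> = vadd V (vadd V (vscale V (- d) b) (vadd V (vscale V c b) s)) (vscale V (-1) s)"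
      using bV that(2) SD(2) by (simp add: V.add_assoc)
    also have "\<dots> = vadd V t (vscale V (-1) s)"
      unfolding that(1) using bV that(2,3) SD(2) V.add_scale[of b "- d" d, symmetric]
      by (simp flip: V.add_assoc)
    finally have *: "vscale V (c - d) b \<in> S" using that SD by auto
    have "c = d"
    proof (rule ccontr)
      assume "c \<noteq> d"
      then have "b = vscale V (inverse (c - d)) (vscale V (c - d) b)" using bV by simp
      then show False using * SD(5) b(2) by metis
    qed
    then show ?thesis using that bV SD V.add_left_cancel by auto
  qed
  define f' where "f' x = (THE z. \<exists>c s. s \<in> S \<and> x = vadd V (vscale V c b) s \<and>
    z = vadd W (vscale W c y) (f s))" for x
  have f': "f' (vadd V (vscale V c b) s) = vadd W (vscale W c y) (f s)" if "s \<in> S" for c s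
    unfolding f'_def by (rule the_equality) (use that uniq in blast)+
  have bS: "\<exists>s'. vadd V x x' = vadd V (vscale V (c + d) b) s' \<and> s' = vadd V s t"
    if "x = vadd V (vscale V c b) s" "x' = vadd V (vscale V d b) t" "s \<in> S" "t \<in> S" for x x' c d s t
    using that bV SD by (simp add: V.add_scale V.add_ac)
  let ?S' = "{vadd V (vscale V c b) s | c s. s \<in> S}"
  have "vs_linear (restr V ?S') W f'"
    unfolding vs_linear_def
  proof (intro conjI ballI allI)
    fix x assume "x \<in> vcarrier (restr V ?S')"
    then obtain c s where x: "x = vadd V (vscale V c b) s" "s \<in> S" by auto
    then show "f' x \<in> vcarrier W" using f' y fl by auto
    have "vscale V d x = vadd V (vscale V (d * c) b) (vscale V d s)" for d
      using x bV SD by (simp add: V.scale_add)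
    then show "f' (vscale (restr V ?S') d x) = vscale W d (f' x)" for d
      using x SD f' y fl by (simp add: W.scale_add)
    fix x' assume "x' \<in> vcarrier (restr V ?S')"
    then obtain d t where x': "x' = vadd V (vscale V d b) t" "t \<in> S" by auto
    then have "f' (vadd V x x') = vadd W (vscale W (c + d) y) (f (vadd V s t))"
      using bS[OF x(1) x'(1) x(2) x'(2)] f' SD x by auto
    then show "f' (vadd (restr V ?S') x x') = vadd W (f' x) (f' x')"
      using x x' f' fl y by (simp add: W.add_scale W.add_ac)
  qed
  moreover have "R x (f' x)" if x: "x \<in> ?S'" for x
  proof -
    obtain c s where x: "x = vadd V (vscale V c b) s" "s \<in> S" using x by auto
    have "R (vscale V c b) (vscale W c y)" "R s (f s)"
      using R b y x fR unfolding total_linear_rel_def by auto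
    then show ?thesis
      using R x f' S TD b unfolding total_linear_rel_def by auto
  qed
  moreover have "f' s = f s" if "s \<in> S" for s
    using f'[OF that, of 0] that bV SD y fl by simp
  ultimately show ?thesis unfolding linear_selection_def by auto
qed

text \<open>The members of a finite spanning list of \<open>T\<close> are adjoined one at a time,
  skipping those already reached; a subspace of \<open>T\<close> containing the whole list is
  \<open>T\<close>.\<close>

lemma linear_selection_extend:
  assumes V: "vs_axioms V" and W: "vs_axioms W"
    and T: "vs_subspace V T" "fin_dim (restr V T)" and R: "total_linear_rel V W T R"
    and S: "vs_subspace V S" "S \<subseteq> T" and f: "linear_selection V W S R f"
  obtains f' where "linear_selection V W T R f'" "\<And>x. x \<in> S \<Longrightarrow> f' x = f x"
proof -
  interpret V: vspace V by (unfold_locales) (rule V)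
  have main: "\<exists>S' f'. vs_subspace V S' \<and> S \<subseteq> S' \<and> S' \<subseteq> T \<and> set bs \<subseteq> S' \<and>
      linear_selection V W S' R f' \<and> (\<forall>x\<in>S. f' x = f x)" if "set bs \<subseteq> T" for bs
    using that
  proof (induction bs)
    case Nil
    then show ?case using S f by auto
  next
    case (Cons b bs)
    then obtain S' f' where S': "vs_subspace V S'" "S \<subseteq> S'" "S' \<subseteq> T" "set bs \<subseteq> S'"
      "linear_selection V W S' R f'" "\<And>x. x \<in> S \<Longrightarrow> f' x = f x" by auto
    show ?case
    proof (cases "b \<in> S'")
      case True
      then show ?thesis using S' by (intro exI[of _ S'] exI[of _ f']) auto
    next
      case False
      let ?S'' = "{vadd V (vscale V c b) s | c s. s \<in> S'}"
      have b: "b \<in> T" "b \<in> vcarrier V" using Cons.prems T V.subspaceD(2) by auto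
      note SD = V.subspaceD[OF S'(1)]
      obtain f'' where "linear_selection V W ?S'' R f''" "\<forall>x\<in>S'. f'' x = f' x"
        using linear_selection_add_vector[OF V W T(1) R S'(1,3,5) b(1) False] by auto
      moreover have "x \<in> ?S''" if "x \<in> S'" for x
        using b SD that by (intro CollectI exI[of _ 0] exI[of _ x]) auto
      then have "S' \<subseteq> ?S''" by blast
      moreover have "b \<in> ?S''"
        using b SD by (auto intro!: exI[of _ 1] exI[of _ "vzero V"])
      moreover have "?S'' \<subseteq> T" using b S' V.subspaceD[OF T(1)] by auto
      ultimately show ?thesis
        using S' V.subspace_add_vector[OF S'(1) b(2)]
        by (intro exI[of _ ?S''] exI[of _ f'']) (auto 4 3)
    qed
  qed
  obtain bs where bs: "set bs \<subseteq> T" "T \<subseteq> lin_span V bs" using T(2) unfolding fin_dim_iff by auto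
  obtain S' f' where S': "vs_subspace V S'" "S' \<subseteq> T" "set bs \<subseteq> S'"
    "linear_selection V W S' R f'" "\<forall>x\<in>S. f' x = f x"
    using main[OF bs(1)] by auto
  have "S' = T" using V.lin_span_subset[OF S'(1,3)] bs S' by auto
  then show thesis using S' that by auto
qed

text \<open>The relation may depend on \<open>p\<close>, yet one \<open>f\<close> serves every
  level. By \<open>R_mono\<close>, a selection on \<open>T p\<close> is still one for
  \<open>R (p + 1)\<close> on that subspace, so it extends to \<open>T (p + 1)\<close>; the
  extensions agree where both are meaningful and can be glued.\<close>

lemma filtered_linear_selection:
  fixes T :: "int \<Rightarrow> 'v set"
  assumes V: "vs_axioms V" and W: "vs_axioms W"
    and T: "\<And>p. vs_subspace V (T p)" "\<And>p. fin_dim (restr V (T p))"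
    and T_mono: "\<And>p. T p \<subseteq> T (p + 1)" and T_zero: "\<And>p. p \<le> p0 \<Longrightarrow> T p = {vzero V}"
    and R: "\<And>p. total_linear_rel V W (T p) (R p)"
    and R_mono: "\<And>p x y. x \<in> T p \<Longrightarrow> R p x y \<Longrightarrow> R (p + 1) x y"
  shows "\<exists>f. \<forall>p. linear_selection V W (T p) (R p) f"
proof -
  interpret V: vspace V by (unfold_locales) (rule V)
  interpret W: vspace W by (unfold_locales) (rule W)
  have zero: "linear_selection V W {vzero V} (R p) f"
    if p: "T p = {vzero V}" and f: "f (vzero V) = vzero W" for p f
  proof -
    obtain y where y: "R p (vzero V) y" "y \<in> vcarrier W"
      using R[of p] unfolding p total_linear_rel_def by blast
    \<comment> \<open>Totality relates the zero vector to some \<open>y\<close>; scaling by 0 shows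
      that it is also related to zero.\<close>
    have "R p (vscale V 0 (vzero V)) (vscale W 0 y)"
      using R[of p] y(1) unfolding p total_linear_rel_def by blast
    then have "R p (vzero V) (vzero W)" using y by simp
    then show ?thesis
      using f by (auto simp: linear_selection_def vs_linear_def)
  qed
  define Q where "Q k f \<longleftrightarrow> linear_selection V W (T (p0 + int k)) (R (p0 + int k)) f" for k f
  have "\<exists>F. \<forall>k. Q k (F k) \<and> (\<forall>x\<in>T (p0 + int k). F (Suc k) x = F k x)"
  proof (rule dependent_nat_choice)
    show "\<exists>f. Q 0 f" unfolding Q_def
      using zero[of p0 "\<lambda>_. vzero W"] T_zero[of p0] by auto
  next
    fix f k assume f: "Q k f"
    have eq: "p0 + int (Suc k) = (p0 + int k) + 1" by simp
    \<comment> \<open>The old selection is reread as a selection for the relation of the next level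
      before it is extended.\<close>
    have "linear_selection V W (T (p0 + int k)) (R (p0 + int (Suc k))) f"
      using f R_mono unfolding Q_def linear_selection_def eq by blast
    then obtain f' where "linear_selection V W (T (p0 + int (Suc k))) (R (p0 + int (Suc k))) f'"
      "\<And>x. x \<in> T (p0 + int k) \<Longrightarrow> f' x = f x"
      using linear_selection_extend[OF V W T(1) T(2) R T(1)] T_mono eq by metis
    then show "\<exists>f'. Q (Suc k) f' \<and> (\<forall>x\<in>T (p0 + int k). f' x = f x)"
      unfolding Q_def by auto
  qed
  then obtain F where F: "\<And>k. Q k (F k)"
    and F_Suc: "\<And>k x. x \<in> T (p0 + int k) \<Longrightarrow> F (Suc k) x = F k x" by blast
  have F_add: "x \<in> T (p0 + int (k + j)) \<and> F (k + j) x = F k x"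
    if "x \<in> T (p0 + int k)" for x k j
  proof (induction j)
    case (Suc j)
    then show ?case using F_Suc[of x "k + j"] T_mono[of "p0 + int (k + j)"]
      by (auto simp: add.assoc add.commute[of 1])
  qed (use that in simp)
  \<comment> \<open>The first level containing \<open>x\<close> supplies the value; all later
    \<open>F k\<close> agree with it by \<open>F_add\<close>.\<close>
  define f where "f x = F (LEAST k. x \<in> T (p0 + int k)) x" for x
  have f_eq: "f x = F k x" if "x \<in> T (p0 + int k)" for x k
  proof -
    let ?k = "LEAST k. x \<in> T (p0 + int k)"
    have "x \<in> T (p0 + int ?k)" "?k \<le> k"
      using LeastI[of "\<lambda>k. x \<in> T (p0 + int k)" k] Least_le[of "\<lambda>k. x \<in> T (p0 + int k)" k] that by auto
    then show ?thesis
      using F_add[of x ?k "k - ?k"] unfolding f_def by simp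
  qed
  have "linear_selection V W (T p) (R p) f" for p
  proof (cases "p0 \<le> p")
    case True
    then have p: "p0 + int (nat (p - p0)) = p" by simp
    have "linear_selection V W (T p) (R p) (F (nat (p - p0)))"
      using F[of "nat (p - p0)"] unfolding Q_def p .
    moreover have "f x = F (nat (p - p0)) x" if "x \<in> T p" for x
      using f_eq[of x "nat (p - p0)"] that unfolding p by simp
    ultimately show ?thesis
      using V.subspaceD[OF T(1)[of p]]
      by (simp add: linear_selection_def vs_linear_def)
  next
    case False
    have "f (vzero V) = F 0 (vzero V)" using f_eq[of "vzero V" 0] T_zero by simp
    also have "\<dots> = vzero W"
      using F[of 0] T_zero[of p0] V.subspace_zero vs_linear_zero[OF _ V.vs_axioms_restr W]
      unfolding Q_def linear_selection_def by fastforce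
    finally show ?thesis using zero[of p f] T_zero[of p] False by simp
  qed
  then show ?thesis by blast
qed

section \<open>Homology of filtered complexes\<close>

locale filtered_complex =
  fixes X :: "('k::field, 'v) fcomplex"
  assumes fc: "is_fc X"
begin

lemma
  shows vs_axioms_fmod: "vs_axioms (fmod X m)"
    and subspace_fsub: "vs_subspace (fmod X m) (fsub X p m)"
    and fin_dim_fsub: "fin_dim (restr (fmod X m) (fsub X p m))"
    and linear_fbd: "vs_linear (restr (fmod X m) (fsub X p m))
      (restr (fmod X (m - 1)) (fsub X p (m - 1))) (fbd X m)"
    and fbd_fbd: "x \<in> fsub X p m \<Longrightarrow> fbd X (m - 1) (fbd X m x) = vzero (fmod X (m - 2))"
    and fsub_mono: "fsub X p m \<subseteq> fsub X (p + 1) m"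
    and fsub_eventually_zero: "\<exists>p0. \<forall>p\<le>p0. \<forall>m. fsub X p m = {vzero (fmod X m)}"
    and finite_fsub_jumps: "finite {p. fsub X p \<noteq> fsub X (p + 1)}"
  using fc unfolding is_fc_def lvl_def by auto

sublocale fmod: vspace "fmod X m" for m
  by unfold_locales (rule vs_axioms_fmod)

lemmas fsubD = fmod.subspaceD[OF subspace_fsub]
lemmas fbdD = vs_linearD[OF linear_fbd, simplified]

lemma fbd_zero: "fbd X m (vzero (fmod X m)) = vzero (fmod X (m - 1))"
  using vs_linear_zero[OF linear_fbd fmod.vs_axioms_restr fmod.vs_axioms_restr] subspace_fsub
  by fastforce

lemma subspace_cycles: "vs_subspace (fmod X m) (cycles X p m)"
  unfolding vs_subspace_def cycles_def
  using fsubD by (auto simp: fbdD fbd_zero)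

lemma boundaryE:
  assumes "b \<in> boundaries X p m"
  obtains y where "y \<in> fsub X p (m + 1)" "b = fbd X (m + 1) y"
  using assms unfolding boundaries_def by auto

lemma subspace_boundaries: "vs_subspace (fmod X m) (boundaries X p m)"
proof -
  have fsub_bd: "boundaries X p m \<subseteq> fsub X p m"
    using fbdD(1)[of _ p "m + 1"] by (auto simp: boundaries_def)
  have "vzero (fmod X m) \<in> boundaries X p m"
    using fbd_zero[of "m + 1"] fsubD(3)[of "m + 1" p] unfolding boundaries_def by force
  moreover have "vadd (fmod X m) x y \<in> boundaries X p m"
    if "x \<in> boundaries X p m" "y \<in> boundaries X p m" for x y
    using that fbdD(2)[of _ p "m + 1", symmetric] fsubD(4)[of _ p "m + 1"]
    by (auto simp: boundaries_def)
  moreover have "vscale (fmod X m) c x \<in> boundaries X p m" if "x \<in> boundaries X p m" for c x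
    using that fbdD(3)[of _ p "m + 1", symmetric] fsubD(5)[of _ p "m + 1"]
    by (auto simp: boundaries_def)
  ultimately show ?thesis
    using fsub_bd fsubD(1) unfolding vs_subspace_def by blast
qed

lemma boundaries_subset_cycles: "boundaries X p m \<subseteq> cycles X p m"
proof
  fix b assume "b \<in> boundaries X p m"
  then obtain y where "y \<in> fsub X p (m + 1)" "b = fbd X (m + 1) y" by (rule boundaryE)
  then show "b \<in> cycles X p m"
    using fbdD(1)[of y p "m + 1"] fbd_fbd[of y p "m + 1"] by (simp add: cycles_def)
qed

lemma cycles_subset_fsub: "cycles X p m \<subseteq> fsub X p m"
  by (auto simp: cycles_def)

lemma cycles_mono: "cycles X p m \<subseteq> cycles X (p + 1) m"
  and boundaries_mono: "boundaries X p m \<subseteq> boundaries X (p + 1) m"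
  using fsub_mono unfolding cycles_def boundaries_def by blast+

sublocale homology: vs_quotient "fmod X m" "cycles X p m" "boundaries X p m" for m p
  by unfold_locales
    (rule subspace_cycles subspace_boundaries boundaries_subset_cycles)+

lemma fin_dim_cycles: "fin_dim (restr (fmod X m) (cycles X p m))"
  using fmod.fin_dim_subspace[OF subspace_cycles cycles_subset_fsub fsubD(1) fin_dim_fsub] .

lemma fin_dim_boundaries: "fin_dim (restr (fmod X m) (boundaries X p m))"
  using fmod.fin_dim_subspace[OF subspace_boundaries boundaries_subset_cycles
      homology.ZD(1) fin_dim_cycles] .

lemma PH_carrierE:
  assumes "A \<in> vcarrier (pspace (PH_obj n X) p)"
  obtains x where "x \<in> cycles X p n" "A = coset (fmod X n) (boundaries X p n) x"
  using assms by (auto simp: PH_obj_def homology_def)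

lemma coset_in_PH:
  "x \<in> cycles X p n \<Longrightarrow> coset (fmod X n) (boundaries X p n) x \<in> vcarrier (pspace (PH_obj n X) p)"
  by (simp add: PH_obj_def homology_def)

lemma linear_inclusion:
  "vs_linear (restr (fmod X m) (cycles X p m)) (restr (fmod X m) (cycles X (p + 1) m)) id"
  using cycles_mono by (auto simp: vs_linear_def)

lemma PH_arr_coset:
  assumes "x \<in> cycles X p n"
  shows "parr (PH_obj n X) p (coset (fmod X n) (boundaries X p n) x) =
    coset (fmod X n) (boundaries X (p + 1) n) x"
  using boundaries_mono assms
  by (simp add: PH_obj_def subset_iff
      qmap_coset[OF homology.vs_quotient_axioms homology.vs_quotient_axioms linear_inclusion])

text \<open>When two consecutive levels coincide, so do their cycles and boundaries, and the arrow
  is the identity on cosets. Hence non-bijective arrows occur only at the finitely many jumps of the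
  filtration.\<close>

lemma obj_imP_PH: "obj_imP (PH_obj n X)"
proof -
  have "fdvs (homology X n p)" for p
    unfolding fdvs_def homology_def
    using homology.vs_axioms_quot homology.fin_dim_quot[OF fin_dim_cycles] by blast
  moreover have "vs_linear (homology X n p) (homology X n (p + 1))
      (qmap (fmod X n) (boundaries X (p + 1) n) id)" for p
    unfolding homology_def
    using linear_qmap[OF homology.vs_quotient_axioms homology.vs_quotient_axioms linear_inclusion]
      boundaries_mono by (simp add: subset_iff)
  moreover have "tempered (PH_obj n X)"
    unfolding tempered_def
  proof (rule finite_subset[OF _ finite_fsub_jumps], clarify)
    fix p
    assume nb: "\<not> bij_betw (parr (PH_obj n X) p) (vcarrier (pspace (PH_obj n X) p))
      (vcarrier (pspace (PH_obj n X) (p + 1)))" and "fsub X p = fsub X (p + 1)"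
    then have eq: "cycles X (p + 1) n = cycles X p n" "boundaries X (p + 1) n = boundaries X p n"
      by (simp_all add: cycles_def boundaries_def)
    have "parr (PH_obj n X) p A = A" if "A \<in> vcarrier (pspace (PH_obj n X) p)" for A
      using that PH_arr_coset by (elim PH_carrierE) (simp add: eq)
    moreover have "vcarrier (pspace (PH_obj n X) (p + 1)) = vcarrier (pspace (PH_obj n X) p)"
      by (simp add: PH_obj_def homology_def eq)
    ultimately show False
      using nb by (simp add: bij_betw_def inj_on_def)
  qed
  moreover have "bounded_below (PH_obj n X)"
  proof -
    obtain p0 where p0: "\<And>p m. p \<le> p0 \<Longrightarrow> fsub X p m = {vzero (fmod X m)}"
      using fsub_eventually_zero by blast
    have "cycles X p n = {vzero (fmod X n)}" if "p \<le> p0" for p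
      using p0[OF that] cycles_subset_fsub homology.ZD(3) by blast
    then show ?thesis
      unfolding bounded_below_def by (auto simp: PH_obj_def homology_def intro!: exI[of _ p0])
  qed
  ultimately show ?thesis
    by (simp add: obj_imP_def obj_P_def is_pvs_def PH_obj_def)
qed

lemma PH_mor_id: "pvs_mor_eq (PH_obj n X) (PH_mor n X (\<lambda>p m x. x)) (\<lambda>p A. A)"
  unfolding pvs_mor_eq_def PH_mor_def qmap_def
  by (auto simp: PH_obj_def homology_def homology.coset_rep')

text \<open>A selection for the relation that \<open>y\<close> lies in level \<open>p\<close> and
  has boundary \<open>g x\<close>. Hypothesis \<open>bd\<close> is levelwise on purpose: the
  bounding chain must exist in the same level as \<open>x\<close>. Taking \<open>g\<close> to be the
  identity on boundaries splits the boundary map.\<close>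

lemma fbd_lift:
  fixes T :: "int \<Rightarrow> 'w set"
  assumes V: "vs_axioms V" and T: "\<And>p. vs_subspace V (T p)" "\<And>p. fin_dim (restr V (T p))"
    and T_mono: "\<And>p. T p \<subseteq> T (p + 1)" and T_zero: "\<And>p. p \<le> p0 \<Longrightarrow> T p = {vzero V}"
    and lin: "\<And>p. vs_linear (restr V (T p)) (fmod X m) g"
    and bd: "\<And>p x. x \<in> T p \<Longrightarrow> g x \<in> boundaries X p m"
  shows "\<exists>h. \<forall>p. vs_linear (restr V (T p)) (fmod X (m + 1)) h \<and>
    (\<forall>x\<in>T p. h x \<in> fsub X p (m + 1) \<and> fbd X (m + 1) (h x) = g x)"
proof -
  let ?R = "\<lambda>p x y. y \<in> fsub X p (m + 1) \<and> fbd X (m + 1) y = g x"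
  have R: "total_linear_rel V (fmod X (m + 1)) (T p) (?R p)" for p
    unfolding total_linear_rel_def
  proof (intro conjI ballI allI impI)
    fix x assume x: "x \<in> T p"
    show "\<exists>y. ?R p x y" using boundaryE[OF bd[OF x]] by metis
  qed (use fsubD[where p = p and m = "m + 1"] fbdD[where p = p and m = "m + 1"]
      vs_linearD[OF lin[of p]] in auto)
  have "\<exists>h. \<forall>p. linear_selection V (fmod X (m + 1)) (T p) (?R p) h"
  proof (rule filtered_linear_selection[where R = ?R, OF V vs_axioms_fmod T T_mono T_zero R])
    show "?R (p + 1) x y" if "?R p x y" for p x y
      using that fsub_mono by blast
  qed
  then obtain h where "\<And>p. linear_selection V (fmod X (m + 1)) (T p) (?R p) h" by blast
  then show ?thesis by (intro exI[of _ h]) (simp add: linear_selection_def)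
qed

end

section \<open>Chain maps: functoriality and fullness of homology\<close>

lemma fc_morD:
  assumes "fc_mor X Y f"
  shows "vs_linear (restr (fmod X m) (fsub X p m)) (restr (fmod Y m) (fsub Y p m)) (f p m)"
    "x \<in> fsub X p m \<Longrightarrow> f p (m - 1) (fbd X m x) = fbd Y m (f p m x)"
    "x \<in> fsub X p m \<Longrightarrow> f (p + 1) m x = f p m x"
  using assms unfolding fc_mor_def lvl_def by auto

lemma fc_mor_comp:
  assumes "fc_mor X Y f" "fc_mor Y Z g"
  shows "fc_mor X Z (\<lambda>p m x. g p m (f p m x))"
  using assms unfolding fc_mor_def lvl_def vs_linear_def by simp

locale filtered_complex_pair = X: filtered_complex X + Y: filtered_complex Y
  for X :: "('k::field, 'v) fcomplex" and Y :: "('k, 'u) fcomplex"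
begin

lemma fc_mor_cycles:
  assumes f: "fc_mor X Y f"
  shows "vs_linear (restr (fmod X m) (cycles X p m)) (restr (fmod Y m) (cycles Y p m)) (f p m)"
proof (rule vs_linear_restr[OF fc_morD(1)[OF f] X.cycles_subset_fsub])
  fix x assume "x \<in> cycles X p m"
  then have x: "x \<in> fsub X p m" "fbd X m x = vzero (fmod X (m - 1))" by (auto simp: cycles_def)
  have "f p (m - 1) (vzero (fmod X (m - 1))) = vzero (fmod Y (m - 1))"
    using vs_linear_zero[OF fc_morD(1)[OF f] X.fmod.vs_axioms_restr Y.fmod.vs_axioms_restr]
      X.subspace_fsub Y.subspace_fsub by simp
  then show "f p m x \<in> cycles Y p m"
    using x fc_morD(2)[OF f x(1)] vs_linearD(1)[OF fc_morD(1)[OF f]] by (simp add: cycles_def)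
qed

lemma fc_mor_boundaries:
  assumes f: "fc_mor X Y f" and "b \<in> boundaries X p m"
  shows "f p m b \<in> boundaries Y p m"
proof -
  obtain y where y: "y \<in> fsub X p (m + 1)" "b = fbd X (m + 1) y"
    using X.boundaryE[OF assms(2)] .
  then show ?thesis
    using fc_morD(2)[OF f y(1)] vs_linearD(1)[OF fc_morD(1)[OF f, of "m + 1" p], of y]
    by (simp add: boundaries_def)
qed

lemma PH_mor_coset:
  assumes "fc_mor X Y f" "x \<in> cycles X p n"
  shows "PH_mor n Y f p (coset (fmod X n) (boundaries X p n) x) =
    coset (fmod Y n) (boundaries Y p n) (f p n x)"
  unfolding PH_mor_def
  by (rule qmap_coset[OF X.homology.vs_quotient_axioms Y.homology.vs_quotient_axioms
        fc_mor_cycles[OF assms(1)] fc_mor_boundaries[OF assms(1)] assms(2)])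

lemma pvs_mor_PH:
  assumes f: "fc_mor X Y f"
  shows "pvs_mor (PH_obj n X) (PH_obj n Y) (PH_mor n Y f)"
  unfolding pvs_mor_def
proof (intro conjI allI ballI)
  fix p
  show "vs_linear (pspace (PH_obj n X) p) (pspace (PH_obj n Y) p) (PH_mor n Y f p)"
    using linear_qmap[OF X.homology.vs_quotient_axioms Y.homology.vs_quotient_axioms
        fc_mor_cycles[OF f] fc_mor_boundaries[OF f]]
    by (simp add: PH_obj_def PH_mor_def homology_def)
  fix A assume "A \<in> vcarrier (pspace (PH_obj n X) p)"
  then obtain x where x: "x \<in> cycles X p n" "A = coset (fmod X n) (boundaries X p n) x"
    by (rule X.PH_carrierE)
  moreover have "x \<in> cycles X (p + 1) n" using x X.cycles_mono by blast
  moreover have "f p n x \<in> cycles Y p n" using vs_linearD(1)[OF fc_mor_cycles[OF f]] x by simp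
  moreover have "f (p + 1) n x = f p n x"
    using x fc_morD(3)[OF f] X.cycles_subset_fsub by blast
  ultimately show "PH_mor n Y f (p + 1) (parr (PH_obj n X) p A) =
      parr (PH_obj n Y) p (PH_mor n Y f p A)"
    by (simp add: X.PH_arr_coset Y.PH_arr_coset PH_mor_coset[OF f])
qed

text \<open>A lift \<open>\<phi>\<close> of \<open>g\<close> to cycles is extended to all chains by \<open>x \<mapsto> \<phi> (x - s (\<partial> x))\<close> with
\<open>s\<close> a section of the boundary map.  It takes values in cycles, hence can vanish in lower
degrees; in degree \<open>n + 1\<close> one uses \<open>\<psi> \<circ> \<partial>\<close> where \<open>\<psi>\<close> lifts \<open>\<phi>\<close> restricted to boundaries.\<close>

lemma PH_full:
  assumes g: "pvs_mor (PH_obj n X) (PH_obj n Y) g"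
  obtains f where "fc_mor X Y f" "pvs_mor_eq (PH_obj n X) (PH_mor n Y f) g"
proof -
  let ?cX = "\<lambda>p. coset (fmod X n) (boundaries X p n)"
  let ?cY = "\<lambda>p. coset (fmod Y n) (boundaries Y p n)"
  have g_lin: "vs_linear (quot (fmod X n) (cycles X p n) (boundaries X p n))
      (quot (fmod Y n) (cycles Y p n) (boundaries Y p n)) (g p)" for p
    using g by (simp add: pvs_mor_def PH_obj_def homology_def)
  have gc_lin: "vs_linear (restr (fmod X n) (cycles X p n))
      (quot (fmod Y n) (cycles Y p n) (boundaries Y p n)) (\<lambda>x. g p (?cX p x))" for p
    using vs_linear_comp[OF X.homology.linear_coset g_lin] .
  \<comment> \<open>Compatibility of \<open>g\<close> with the arrows enters here: a cycle
    representing the image of a class at level \<open>p\<close> still does so at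
    \<open>p + 1\<close>. This is the monotonicity of the relation \<open>?R\<close> below.\<close>
  have g_arr: "g (p + 1) (?cX (p + 1) x) = ?cY (p + 1) y"
    if "x \<in> cycles X p n" "y \<in> cycles Y p n" "?cY p y = g p (?cX p x)" for p x y
    using g X.coset_in_PH[OF that(1)] that X.PH_arr_coset Y.PH_arr_coset
    unfolding pvs_mor_def by metis
  obtain p0 where p0: "\<And>p m. p \<le> p0 \<Longrightarrow> fsub X p m = {vzero (fmod X m)}"
    using X.fsub_eventually_zero by blast
  have Z0: "cycles X p m = {vzero (fmod X m)}" if "p \<le> p0" for p m
    using p0[OF that] X.cycles_subset_fsub X.homology.ZD(3) by blast
  have B0: "boundaries X p m = {vzero (fmod X m)}" if "p \<le> p0" for p m
    using Z0[OF that] X.boundaries_subset_cycles X.homology.BD(3) by blast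
  let ?R = "\<lambda>p x y. y \<in> cycles Y p n \<and> ?cY p y = g p (?cX p x)"
  have R: "total_linear_rel (fmod X n) (fmod Y n) (cycles X p n) (?R p)" for p
    unfolding total_linear_rel_def
  proof (intro conjI ballI allI impI)
    fix x assume x: "x \<in> cycles X p n"
    then show "\<exists>y. ?R p x y"
      using vs_linearD(1)[OF gc_lin] by auto (metis imageE)
  qed (use Y.homology.ZD vs_linearD(2,3)[OF gc_lin[of p]]
      vs_linearD(2,3)[OF Y.homology.linear_coset[of n p]] in auto)
  have "\<exists>\<phi>. \<forall>p. linear_selection (fmod X n) (fmod Y n) (cycles X p n) (?R p) \<phi>"
  proof (rule filtered_linear_selection[where R = ?R, OF X.vs_axioms_fmod Y.vs_axioms_fmod
        X.subspace_cycles X.fin_dim_cycles X.cycles_mono Z0 R])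
    show "?R (p + 1) x y" if "x \<in> cycles X p n" "?R p x y" for p x y
      using that g_arr Y.cycles_mono[of p n] by auto
  qed
  then obtain \<phi> where \<phi>: "\<And>p. linear_selection (fmod X n) (fmod Y n) (cycles X p n) (?R p) \<phi>"
    by blast
  have \<phi>_lin: "vs_linear (restr (fmod X n) (cycles X p n)) (fmod Y n) \<phi>"
    and \<phi>_cyc: "x \<in> cycles X p n \<Longrightarrow> \<phi> x \<in> cycles Y p n"
    and \<phi>_g: "x \<in> cycles X p n \<Longrightarrow> ?cY p (\<phi> x) = g p (?cX p x)" for p x
    using \<phi> unfolding linear_selection_def by auto
  \<comment> \<open>A boundary has zero class and \<open>g\<close> preserves zero, so
    \<open>\<phi> b\<close> is a cycle with zero class.\<close>
  have \<phi>_bd: "\<phi> b \<in> boundaries Y p n" if b: "b \<in> boundaries X p n" for p b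
  proof -
    have bZ: "b \<in> cycles X p n" "b \<in> vcarrier (fmod X n)"
      using b X.boundaries_subset_cycles X.homology.BD by blast+
    have "?cY p (\<phi> b) = g p (?cX p (vzero (fmod X n)))"
      using \<phi>_g[OF bZ(1)] iffD2[OF X.homology.coset_eq_zero_iff[OF bZ(2)] b] by simp
    also have "\<dots> = ?cY p (vzero (fmod Y n))"
      using vs_linear_zero[OF g_lin X.homology.vs_axioms_quot Y.homology.vs_axioms_quot] by simp
    finally show ?thesis
      using Y.homology.coset_eq_zero_iff \<phi>_cyc[OF bZ(1)] Y.homology.ZD(2) by blast
  qed
  have "\<exists>\<psi>. \<forall>p. vs_linear (restr (fmod X n) (boundaries X p n)) (fmod Y (n + 1)) \<psi> \<and>
      (\<forall>x\<in>boundaries X p n. \<psi> x \<in> fsub Y p (n + 1) \<and> fbd Y (n + 1) (\<psi> x) = \<phi> x)"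
  proof (rule Y.fbd_lift[where T = "\<lambda>p. boundaries X p n" and g = \<phi>, OF X.vs_axioms_fmod
        X.subspace_boundaries X.fin_dim_boundaries X.boundaries_mono B0 _ \<phi>_bd])
    show "vs_linear (restr (fmod X n) (boundaries X p n)) (fmod Y n) \<phi>" for p
      using \<phi>_lin[of p] X.boundaries_subset_cycles[of p n] unfolding vs_linear_def
      by (simp add: subset_iff)
  qed
  then obtain \<psi> where
    \<psi>_lin: "\<And>p. vs_linear (restr (fmod X n) (boundaries X p n)) (fmod Y (n + 1)) \<psi>"
    and \<psi>_fsub: "\<And>p x. x \<in> boundaries X p n \<Longrightarrow> \<psi> x \<in> fsub Y p (n + 1)"
    and \<psi>_bd: "\<And>p x. x \<in> boundaries X p n \<Longrightarrow> fbd Y (n + 1) (\<psi> x) = \<phi> x"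
    by blast
  \<comment> \<open>The degree \<open>n - 1 + 1\<close> arises from using \<open>fbd_lift\<close> at
    \<open>n - 1\<close>; it is normalized to \<open>n\<close> when \<open>s\<close> is
    obtained.\<close>
  have "\<exists>s. \<forall>p. vs_linear (restr (fmod X (n - 1)) (boundaries X p (n - 1))) (fmod X (n - 1 + 1)) s \<and>
      (\<forall>x\<in>boundaries X p (n - 1). s x \<in> fsub X p (n - 1 + 1) \<and> fbd X (n - 1 + 1) (s x) = x)"
  proof (rule X.fbd_lift[where T = "\<lambda>p. boundaries X p (n - 1)", OF X.vs_axioms_fmod
        X.subspace_boundaries X.fin_dim_boundaries X.boundaries_mono B0])
    show "vs_linear (restr (fmod X (n - 1)) (boundaries X p (n - 1))) (fmod X (n - 1)) (\<lambda>x. x)" for p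
      using X.homology.BD(2) by (auto simp: vs_linear_def)
  qed
  then obtain s where
    s_lin: "\<And>p. vs_linear (restr (fmod X (n - 1)) (boundaries X p (n - 1))) (fmod X n) s"
    and s_fsub: "\<And>p x. x \<in> boundaries X p (n - 1) \<Longrightarrow> s x \<in> fsub X p n"
    and s_bd: "\<And>p x. x \<in> boundaries X p (n - 1) \<Longrightarrow> fbd X n (s x) = x"
    by auto
  have zero: "\<phi> (vzero (fmod X n)) = vzero (fmod Y n)"
    "\<psi> (vzero (fmod X n)) = vzero (fmod Y (n + 1))"
    "s (vzero (fmod X (n - 1))) = vzero (fmod X n)"
    \<comment> \<open>Level 0 is an arbitrary choice: the zero vector belongs to every
      level.\<close>
    using vs_linear_zero[OF \<phi>_lin[of 0] X.fmod.vs_axioms_restr[OF X.subspace_cycles] Y.vs_axioms_fmod]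
      vs_linear_zero[OF \<psi>_lin[of 0] X.fmod.vs_axioms_restr[OF X.subspace_boundaries] Y.vs_axioms_fmod]
      vs_linear_zero[OF s_lin[of 0] X.fmod.vs_axioms_restr[OF X.subspace_boundaries] X.vs_axioms_fmod]
    by simp_all
  have bd_in: "fbd X n x \<in> boundaries X p (n - 1)" if "x \<in> fsub X p n" for p x
    using that by (simp add: boundaries_def)
  have bd_in1: "fbd X (n + 1) x \<in> boundaries X p n" if "x \<in> fsub X p (n + 1)" for p x
    using that by (simp add: boundaries_def)
  define r where "r x = vadd (fmod X n) x (vscale (fmod X n) (-1) (s (fbd X n x)))" for x
  have r_cyc: "r x \<in> cycles X p n" if "x \<in> fsub X p n" for p x
    unfolding r_def using that s_fsub s_bd bd_in[OF that] X.fsubD X.fbdD(1)[OF that]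
    by (simp add: cycles_def X.fbdD(2,3)[of _ p n])
  have r_lin: "vs_linear (restr (fmod X n) (fsub X p n)) (restr (fmod X n) (cycles X p n)) r" for p
    using r_cyc unfolding vs_linear_def
    by (simp add: r_def X.fbdD[of _ p n] vs_linearD[OF s_lin[of p], simplified] bd_in X.fsubD(2)[of _ p n]
        X.fmod.scale_add X.fmod.add_ac mult.commute)
  have r_id: "r x = x" if "x \<in> cycles X p n" for p x
    using that zero X.homology.ZD(2) by (auto simp: r_def cycles_def)
  \<comment> \<open>The right-hand side ignores \<open>p\<close>, which settles compatibility with
    the inclusions at once.\<close>
  define f where "f p m x = (if m = n then \<phi> (r x) else if m = n + 1 then \<psi> (fbd X m x)
    else vzero (fmod Y m))" for p :: int and m x
  have f_fsub: "f p m x \<in> fsub Y p m" if "x \<in> fsub X p m" for p m x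
    using that subsetD[OF Y.cycles_subset_fsub \<phi>_cyc[OF r_cyc]] \<psi>_fsub bd_in1 Y.fsubD(3)
    by (auto simp: f_def)
  have "vs_linear (restr (fmod X m) (fsub X p m)) (fmod Y m) (f p m)" for p m
  proof -
    consider "m = n" | "m = n + 1" | "m \<noteq> n" "m \<noteq> n + 1" by blast
    then show ?thesis
    proof cases
      case 1
      then show ?thesis using vs_linear_comp[OF r_lin \<phi>_lin] by (simp add: f_def vs_linear_def)
    next
      case 2
      have "vs_linear (restr (fmod X (n + 1)) (fsub X p (n + 1))) (restr (fmod X n) (boundaries X p n))
          (fbd X (n + 1))"
        using X.linear_fbd[of "n + 1" p] bd_in1 by (simp add: vs_linear_def)
      moreover have "f p m = (\<lambda>x. \<psi> (fbd X (n + 1) x))" using 2 by (simp add: f_def fun_eq_iff)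
      ultimately show ?thesis using vs_linear_comp[OF _ \<psi>_lin] 2 by simp
    qed (simp add: vs_linear_def f_def)
  qed
  then have lin: "vs_linear (lvl X p m) (lvl Y p m) (f p m)" for p m
    using f_fsub unfolding lvl_def vs_linear_def by simp
  have comm: "f p (m - 1) (fbd X m x) = fbd Y m (f p m x)" if x: "x \<in> fsub X p m" for p m x
  proof -
    \<comment> \<open>In degree \<open>n\<close> both sides vanish because
      \<open>\<phi> (r x)\<close> is a cycle. In degree \<open>n + 1\<close>, \<open>r\<close> fixes
      boundaries and \<open>\<psi>\<close> lifts \<open>\<phi>\<close>. In degree
      \<open>n + 2\<close> two consecutive boundary maps compose to zero. Elsewhere both components
      of \<open>f\<close> are zero.\<close>
    consider "m = n" | "m = n + 1" | "m = n + 2" | "m \<noteq> n" "m \<noteq> n + 1" "m \<noteq> n + 2" by blast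
    then show ?thesis
    proof cases
      case 1
      have "\<phi> (r x) \<in> cycles Y p n" using x 1 \<phi>_cyc r_cyc by auto
      then show ?thesis using 1 by (simp add: f_def cycles_def)
    next
      case 2
      have b: "fbd X (n + 1) x \<in> boundaries X p n" using bd_in1 x 2 by simp
      then have "r (fbd X (n + 1) x) = fbd X (n + 1) x"
        using X.boundaries_subset_cycles r_id by blast
      then show ?thesis using 2 b \<psi>_bd by (simp add: f_def)
    next
      case 3
      then show ?thesis using x X.fbd_fbd[OF x] zero Y.fbd_zero[of m] by (simp add: f_def add.commute)
    next
      case 4
      then show ?thesis using Y.fbd_zero[of m] by (simp add: f_def)
    qed
  qed
  have f: "fc_mor X Y f"
    unfolding fc_mor_def using lin comm by (simp add: f_def)
  have "pvs_mor_eq (PH_obj n X) (PH_mor n Y f) g"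
    unfolding pvs_mor_eq_def
  proof (intro allI ballI)
    fix p A assume "A \<in> vcarrier (pspace (PH_obj n X) p)"
    then obtain x where "x \<in> cycles X p n" "A = ?cX p x" by (rule X.PH_carrierE)
    then show "PH_mor n Y f p A = g p A"
      using PH_mor_coset[OF f] \<phi>_g r_id by (simp add: f_def)
  qed
  with f show thesis by (rule that)
qed

end

lemma PH_mor_comp:
  assumes "is_fc X" "is_fc Y" "is_fc Z" and f: "fc_mor X Y f" and g: "fc_mor Y Z g"
  shows "pvs_mor_eq (PH_obj n X) (PH_mor n Z (\<lambda>p m x. g p m (f p m x)))
    (\<lambda>p A. PH_mor n Z g p (PH_mor n Y f p A))"
proof -
  interpret XY: filtered_complex_pair X Y by unfold_locales fact+
  interpret YZ: filtered_complex_pair Y Z by unfold_locales fact+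
  interpret XZ: filtered_complex_pair X Z by unfold_locales
  show ?thesis
    unfolding pvs_mor_eq_def
  proof (intro allI ballI)
    fix p A assume "A \<in> vcarrier (pspace (PH_obj n X) p)"
    then obtain x where x: "x \<in> cycles X p n" "A = coset (fmod X n) (boundaries X p n) x"
      by (rule XY.X.PH_carrierE)
    moreover have "f p n x \<in> cycles Y p n"
      using vs_linearD(1)[OF XY.fc_mor_cycles[OF f]] x by simp
    ultimately show "PH_mor n Z (\<lambda>p m x. g p m (f p m x)) p A = PH_mor n Z g p (PH_mor n Y f p A)"
      by (simp add: XY.PH_mor_coset[OF f] YZ.PH_mor_coset[OF g]
          XZ.PH_mor_coset[OF fc_mor_comp[OF f g]])
  qed
qed

section \<open>Realizing persistence vector spaces\<close>

context vs_quotient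
begin

text \<open>The isomorphism and its inverse are described by their values on representatives,
  because the composites and the compatibility with arrows are checked there later.\<close>

lemma first_isomorphism:
  assumes W: "vs_axioms W" and f: "vs_linear (restr V Z) W f" "f ` Z = vcarrier W"
    and ker: "B = {x \<in> Z. f x = vzero W}"
  obtains g h where "vs_linear (quot V Z B) W g" "vs_linear W (quot V Z B) h"
    "\<And>x. x \<in> Z \<Longrightarrow> g (coset V B x) = f x" "\<And>x. x \<in> Z \<Longrightarrow> h (f x) = coset V B x"
proof -
  interpret W: vspace W by unfold_locales (rule W)
  note fD = vs_linearD[OF f(1), simplified]
  define g where "g A = f (rep A)" for A
  define h where "h w = coset V B (SOME x. x \<in> Z \<and> f x = w)" for w
  have g: "g (coset V B x) = f x" if x: "x \<in> Z" for x
  proof -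
    obtain b where "b \<in> B" "rep (coset V B x) = vadd V x b" using rep_coset x ZD(2) by metis
    then show ?thesis using x fD ker by (auto simp: g_def)
  qed
  have h: "h (f x) = coset V B x" if x: "x \<in> Z" for x
  proof -
    let ?y = "SOME y. y \<in> Z \<and> f y = f x"
    have y: "?y \<in> Z" "f ?y = f x" using someI[of "\<lambda>y. y \<in> Z \<and> f y = f x" x] x by auto
    \<comment> \<open>The difference of the chosen preimage and \<open>x\<close> lies in the kernel
      \<open>B\<close>, so both have the same coset.\<close>
    let ?b = "vadd V (vscale V (-1) x) ?y"
    have "vadd W (vscale W (-1) (f x)) (f x) = vzero W"
      using fD(1)[OF x] W.add_commute W.add_neg W.scale_closed by metis
    then have "?b \<in> B" using x y fD ZD(4,5) ker by simp
    moreover have "?y = vadd V x ?b" using x y(1) ZD(2) by simp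
    ultimately show ?thesis
      unfolding h_def using coset_eq_iff[of x ?y] x y ZD(2) by blast
  qed
  have "vs_linear (quot V Z B) W g"
    using f(1) g ZD by (intro linear_from_quot) (simp add: vs_linear_def)
  moreover have "vs_linear W (quot V Z B) h"
  proof (rule vs_linear_from_image[OF f(1) _ _ vs_axioms_restr[OF subspace_Z]])
    show "vs_linear (restr V Z) (quot V Z B) (\<lambda>x. h (f x))"
      using linear_coset h ZD by (simp add: vs_linear_def)
  qed (simp add: f(2))
  ultimately show thesis using that g h by blast
qed

end

section \<open>Coordinate subspaces of the space of scalar sequences\<close>

definition fun_vs :: "('k::field, nat \<Rightarrow> 'k) vs" where
  "fun_vs = \<lparr> vcarrier = UNIV, vadd = (\<lambda>x y i. x i + y i), vzero = (\<lambda>_. 0),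
    vscale = (\<lambda>c x i. c * x i) \<rparr>"

lemma fun_vs_simps [simp]:
  "vcarrier fun_vs = UNIV" "vadd fun_vs x y = (\<lambda>i. x i + y i)" "vzero fun_vs = (\<lambda>_. 0)"
  "vscale fun_vs c x = (\<lambda>i. c * x i)"
  by (simp_all add: fun_vs_def)

lemma vs_axioms_fun_vs: "vs_axioms fun_vs"
  unfolding vs_axioms_def
  by (auto simp: algebra_simps fun_eq_iff intro: exI[of _ "\<lambda>i. - x i" for x])

interpretation fun_vs: vspace fun_vs
  by unfold_locales (rule vs_axioms_fun_vs)

text \<open>A filtered complex needs one ambient space for all levels, however many generators they
  have. Initial coordinate subspaces of the sequence space are literally nested, so adding
  generators at the end of a list becomes an inclusion.\<close>

definition fun_upto :: "nat \<Rightarrow> (nat \<Rightarrow> 'k::field) set" where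
  "fun_upto N = {x. \<forall>i\<ge>N. x i = 0}"

lemma subspace_fun_upto: "vs_subspace fun_vs (fun_upto N)"
  by (auto simp: vs_subspace_def fun_upto_def)

context vspace
begin

lemma lincomb_append:
  assumes "length cs = length bs" "set bs \<subseteq> vcarrier V" "set bs' \<subseteq> vcarrier V"
  shows "lincomb V (cs @ cs') (bs @ bs') = vadd V (lincomb V cs bs) (lincomb V cs' bs')"
  using assms
  by (induction cs bs rule: list_induct2)
    (simp_all add: lincomb_in_subspace[OF subspace_carrier] add_assoc)

lemma lincomb_map_add:
  assumes "length is = length bs" "set bs \<subseteq> vcarrier V"
  shows "lincomb V (map (\<lambda>i. x i + y i) is) bs =
    vadd V (lincomb V (map x is) bs) (lincomb V (map y is) bs)"
  using assms
  by (induction "is" bs rule: list_induct2)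
    (simp_all add: lincomb_in_subspace[OF subspace_carrier] add_scale add_ac)

lemma lincomb_map_scale:
  assumes "length is = length bs" "set bs \<subseteq> vcarrier V"
  shows "lincomb V (map (\<lambda>i. c * x i) is) bs = vscale V c (lincomb V (map x is) bs)"
  using assms
  by (induction "is" bs rule: list_induct2)
    (simp_all add: lincomb_in_subspace[OF subspace_carrier] scale_add)

lemma lincomb_zero:
  assumes "\<forall>c\<in>set cs. c = 0" "set bs \<subseteq> vcarrier V" shows "lincomb V cs bs = vzero V"
  using assms
proof (induction bs arbitrary: cs)
  case (Cons b bs) then show ?case by (cases cs) (auto simp: lincomb_def)
qed simp

lemma linear_lincomb:
  assumes "set bs \<subseteq> vcarrier V"
  shows "vs_linear (restr fun_vs S) V (\<lambda>x. lincomb V (map x [0..<length bs]) bs)"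
  using assms
  by (simp add: vs_linear_def lincomb_map_add lincomb_map_scale lincomb_in_subspace[OF subspace_carrier])

lemma lincomb_fun_upto_image:
  "(\<lambda>x. lincomb V (map x [0..<length bs]) bs) ` fun_upto (length bs) = lin_span V bs"
proof (intro equalityI subsetI)
  fix v assume "v \<in> lin_span V bs"
  then obtain cs where cs: "length cs = length bs" "v = lincomb V cs bs"
    by (auto simp: lin_span_def)
  define x where "x i = (if i < length bs then cs ! i else 0)" for i
  have "map x [0..<length bs] = cs" using cs by (auto simp: x_def intro: nth_equalityI)
  moreover have "x \<in> fun_upto (length bs)" by (simp add: x_def fun_upto_def)
  ultimately show "v \<in> (\<lambda>x. lincomb V (map x [0..<length bs]) bs) ` fun_upto (length bs)"
    using cs by force
qed (auto simp: lin_span_def)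

end

lemma fin_dim_fun_upto: "fin_dim (restr fun_vs (fun_upto N))"
proof -
  define u :: "nat \<Rightarrow> nat \<Rightarrow> 'a" where "u = (\<lambda>j i. if i = j then 1 else 0)"
  have x: "x = lincomb fun_vs (map x [0..<N]) (map u [0..<N])" if "x \<in> fun_upto N" for x
    using that
  proof (induction N arbitrary: x)
    case 0
    then show ?case by (auto simp: fun_upto_def)
  next
    case (Suc N)
    \<comment> \<open>Clearing coordinate \<open>N\<close> keeps the first \<open>N\<close>
      coefficients and makes the induction hypothesis applicable; the last unit vector
      \<open>u N\<close> restores the cleared entry.\<close>
    have "map x [0..<N] = map (x(N := 0)) [0..<N]" by simp
    moreover have "x(N := 0) \<in> fun_upto N"
      using Suc.prems by (auto simp: fun_upto_def)
    then have "x(N := 0) = lincomb fun_vs (map (x(N := 0)) [0..<N]) (map u [0..<N])"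
      by (rule Suc.IH)
    ultimately have "lincomb fun_vs (map x [0..<N]) (map u [0..<N]) = x(N := 0)" by simp
    then show ?case
      by (simp add: fun_vs.lincomb_append) (auto simp: u_def)
  qed
  have "fun_upto N \<subseteq> lin_span fun_vs (map u [0..<N])"
    unfolding lin_span_def using x by force
  moreover have "set (map u [0..<N]) \<subseteq> fun_upto N" by (auto simp: u_def fun_upto_def)
  ultimately show ?thesis unfolding fin_dim_iff
    by (intro exI[of _ "map u [0..<N]"]) simp
qed

text \<open>Generators of one level are pushed forward to the next; new ones are added only at the
finitely many arrows that are not bijective, so that the number of generators stabilizes.\<close>

lemma compatible_generators:
  fixes W :: "('k::field, 'w) pvs"
  assumes W: "obj_imP W"
  obtains G E :: "int \<Rightarrow> 'w list" and p0 :: int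
  where "\<And>p. set (G p) \<subseteq> vcarrier (pspace W p)"
    "\<And>p. lin_span (pspace W p) (G p) = vcarrier (pspace W p)"
    "\<And>p. G (p + 1) = map (parr W p) (G p) @ E p"
    "\<And>p. bij_betw (parr W p) (vcarrier (pspace W p)) (vcarrier (pspace W (p + 1))) \<Longrightarrow> E p = []"
    "\<And>p. p \<le> p0 \<Longrightarrow> G p = []"
proof -
  let ?C = "\<lambda>p. vcarrier (pspace W p)"
  let ?bij = "\<lambda>p. bij_betw (parr W p) (?C p) (?C (p + 1))"
  obtain p0 where p0: "\<And>p. p \<le> p0 \<Longrightarrow> ?C p = {vzero (pspace W p)}"
    using W unfolding obj_imP_def bounded_below_def by blast
  have fd: "fdvs (pspace W p)" and arr: "vs_linear (pspace W p) (pspace W (p + 1)) (parr W p)" for p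
    using W unfolding obj_imP_def obj_P_def is_pvs_def by auto
  interpret W: vspace "pspace W p" for p
    by unfold_locales (use fd in \<open>simp add: fdvs_def\<close>)
  have "\<exists>bs. set bs \<subseteq> ?C p \<and> ?C p \<subseteq> lin_span (pspace W p) bs" for p
    using fd[of p] by (simp add: fdvs_def fin_dim_iff)
  then obtain bs where bs: "\<And>p. set (bs p) \<subseteq> ?C p" "\<And>p. ?C p \<subseteq> lin_span (pspace W p) (bs p)"
    by metis
  \<comment> \<open>A full spanning list of the next level is appended, since redundant generators
    only enlarge the kernel later. Nothing is appended below \<open>p0\<close>, which keeps
    \<open>G\<close> empty up to \<open>p0\<close>.\<close>
  define E where "E p = (if ?bij p \<or> p < p0 then [] else bs (p + 1))" for p
  define H where "H = rec_nat [] (\<lambda>k l. map (parr W (p0 + int k)) l @ E (p0 + int k))"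
  define G where "G p = H (nat (p - p0))" for p
  have G0: "G p = []" if "p \<le> p0" for p using that by (simp add: G_def H_def)
  have G_Suc: "G (p + 1) = map (parr W p) (G p) @ E p" for p
  proof (cases "p0 \<le> p")
    case True
    then have "nat (p + 1 - p0) = Suc (nat (p - p0))" "p0 + int (nat (p - p0)) = p" by auto
    then show ?thesis by (simp add: G_def H_def)
  next
    case False
    then show ?thesis using G0[of p] G0[of "p + 1"] by (simp add: E_def)
  qed
  have main: "set (G p) \<subseteq> ?C p \<and> ?C p \<subseteq> lin_span (pspace W p) (G p)" for p
  proof (cases "p0 \<le> p")
    case True
    then show ?thesis
    proof (induction p rule: int_ge_induct)
      case base
      then show ?case using G0[of p0] p0[of p0] by simp
    next
      case (step p)
      have GC: "set (G (p + 1)) \<subseteq> ?C (p + 1)"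
        using step bs(1)[of "p + 1"] vs_linearD(1)[OF arr[of p]] by (auto simp: G_Suc E_def)
      note span = W.subspace_lin_span[OF GC]
      have "?C (p + 1) \<subseteq> lin_span (pspace W (p + 1)) (G (p + 1))"
      proof (cases "?bij p")
        case True
        show ?thesis
        proof
          fix w assume "w \<in> ?C (p + 1)"
          then obtain v where v: "v \<in> ?C p" "w = parr W p v"
            using True unfolding bij_betw_def by blast
          then obtain cs where "length cs = length (G p)" "v = lincomb (pspace W p) cs (G p)"
            using step.IH unfolding lin_span_def by blast
          moreover have "parr W p (vzero (pspace W p)) = vzero (pspace W (p + 1))"
            using vs_linear_zero[OF arr W.vs_ax W.vs_ax] .
          ultimately have "w = lincomb (pspace W (p + 1)) cs (G (p + 1))" "length cs = length (G (p + 1))"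
            using lincomb_image[OF W.vs_ax arr] step.IH v True by (simp_all add: G_Suc E_def)
          then show "w \<in> lin_span (pspace W (p + 1)) (G (p + 1))"
            unfolding lin_span_def by blast
        qed
      next
        case False
        then have "set (bs (p + 1)) \<subseteq> set (G (p + 1))"
          using step.hyps by (simp add: G_Suc E_def)
        then have "lin_span (pspace W (p + 1)) (bs (p + 1)) \<subseteq> lin_span (pspace W (p + 1)) (G (p + 1))"
          using W.lin_span_subset[OF span] W.set_subset_lin_span[OF GC] by blast
        then show ?thesis using bs(2)[of "p + 1"] by blast
      qed
      then show ?case using GC by blast
    qed
  next
    case False
    then show ?thesis using G0[of p] p0[of p] by simp
  qed
  have "lin_span (pspace W p) (G p) = ?C p" for p
    using main[of p] W.lin_span_subset[OF W.subspace_carrier] by blast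
  then show thesis
    using that[of G E p0] main G_Suc G0 by (simp add: E_def)
qed

text \<open>Level \<open>p\<close> is the quotient of the space \<open>F p\<close> freely spanned by the generators by the
kernel \<open>K p\<close> of the evaluation \<open>e p\<close>.  Placing \<open>F p\<close> in degree \<open>n\<close> and \<open>K p\<close> in degree \<open>n + 1\<close>,
with the inclusion as boundary map, gives the required filtered complex.\<close>

lemma PH_essentially_surjective:
  fixes W :: "('k::field, 'w) pvs"
  assumes W: "obj_imP W"
  obtains X :: "('k, nat \<Rightarrow> 'k) fcomplex" where "is_fc X" "pvs_iso (PH_obj n X) W"
proof -
  let ?W = "pspace W"
  obtain G E p0 where G: "\<And>p. set (G p) \<subseteq> vcarrier (?W p)"
    and G_span: "\<And>p. lin_span (?W p) (G p) = vcarrier (?W p)"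
    and G_Suc: "\<And>p. G (p + 1) = map (parr W p) (G p) @ E p"
    and E: "\<And>p. bij_betw (parr W p) (vcarrier (?W p)) (vcarrier (?W (p + 1))) \<Longrightarrow> E p = []"
    and G0: "\<And>p. p \<le> p0 \<Longrightarrow> G p = []"
    using compatible_generators[OF W] by metis
  have arr: "vs_linear (?W p) (?W (p + 1)) (parr W p)" for p
    using W unfolding obj_imP_def obj_P_def is_pvs_def by auto
  interpret W: vspace "?W p" for p
    using W by unfold_locales (simp add: obj_imP_def obj_P_def is_pvs_def fdvs_def)
  have arr0: "parr W p (vzero (?W p)) = vzero (?W (p + 1))" for p
    using vs_linear_zero[OF arr W.vs_ax W.vs_ax] .
  define F :: "int \<Rightarrow> (nat \<Rightarrow> 'k) set" where "F p = fun_upto (length (G p))" for p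
  define e where "e p x = lincomb (?W p) (map x [0..<length (G p)]) (G p)" for p and x :: "nat \<Rightarrow> 'k"
  define K where "K p = {x \<in> F p. e p x = vzero (?W p)}" for p
  have e_lin: "vs_linear (restr fun_vs S) (?W p) (e p)" for p S
    unfolding e_def using W.linear_lincomb[OF G] .
  note eD = vs_linearD[OF e_lin[of UNIV], simplified]
  have e_surj: "e p ` F p = vcarrier (?W p)" for p
    unfolding e_def F_def using W.lincomb_fun_upto_image G_span by simp
  have e_zero: "e p (\<lambda>_. 0) = vzero (?W p)" for p
    unfolding e_def using W.lincomb_zero[OF _ G] by simp
  have F_mono: "F p \<subseteq> F (p + 1)" for p
    by (auto simp: F_def fun_upto_def G_Suc)
  \<comment> \<open>On \<open>F p\<close> the coordinates belonging to the new generators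
    \<open>E p\<close> vanish, and the remaining ones weigh the pushed-forward generators. So
    evaluation turns the inclusion of \<open>F p\<close> into the arrow of \<open>W\<close>.\<close>
  have e_arr: "e (p + 1) x = parr W p (e p x)" if x: "x \<in> F p" for p x
  proof -
    let ?N = "length (G p)" and ?M = "length (E p)"
    have len: "[0..<length (G (p + 1))] = [0..<?N] @ [?N..<?N + ?M]"
      unfolding G_Suc using upt_add_eq_append[of 0 ?N ?M] by simp
    have E_car: "set (E p) \<subseteq> vcarrier (?W (p + 1))" "set (map (parr W p) (G p)) \<subseteq> vcarrier (?W (p + 1))"
      using G[of "p + 1"] unfolding G_Suc by auto
    have "e (p + 1) x = vadd (?W (p + 1)) (lincomb (?W (p + 1)) (map x [0..<?N]) (map (parr W p) (G p)))
        (lincomb (?W (p + 1)) (map x [?N..<?N + ?M]) (E p))"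
      unfolding e_def len unfolding G_Suc map_append
      using E_car by (intro W.lincomb_append) auto
    also have "lincomb (?W (p + 1)) (map x [?N..<?N + ?M]) (E p) = vzero (?W (p + 1))"
      using x E_car(1) by (intro W.lincomb_zero) (auto simp: F_def fun_upto_def)
    also have "lincomb (?W (p + 1)) (map x [0..<?N]) (map (parr W p) (G p)) = parr W p (e p x)"
      unfolding e_def using lincomb_image[OF W.vs_ax arr arr0 G] by simp
    finally show ?thesis
      using vs_linearD(1)[OF arr] eD(1) by simp
  qed
  have K_mono: "K p \<subseteq> K (p + 1)" for p
    using F_mono by (auto simp: K_def e_arr arr0)
  have F_sub: "vs_subspace fun_vs (F p)" for p
    unfolding F_def by (rule subspace_fun_upto)
  have K_sub: "vs_subspace fun_vs (K p)" for p
    using fun_vs.subspaceD[OF F_sub[of p]] e_zero by (auto simp: vs_subspace_def K_def eD)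
  have F0: "F p = {\<lambda>_. 0}" if "p \<le> p0" for p
    using G0[OF that] by (auto simp: F_def fun_upto_def)
  have K0: "K p = {\<lambda>_. 0}" if "p \<le> p0" for p
    using F0[OF that] e_zero by (auto simp: K_def)
  \<comment> \<open>A bijective arrow adds no generators, and by injectivity it creates no new
    relations.\<close>
  have FK_stable: "F (p + 1) = F p \<and> K (p + 1) = K p"
    if bij: "bij_betw (parr W p) (vcarrier (?W p)) (vcarrier (?W (p + 1)))" for p
  proof -
    have F_eq: "F (p + 1) = F p" using E[OF bij] by (simp add: F_def G_Suc)
    have "parr W p w = vzero (?W (p + 1)) \<longleftrightarrow> w = vzero (?W p)" if "w \<in> vcarrier (?W p)" for w
      using that bij arr0 unfolding bij_betw_def inj_on_def by (metis W.zero_closed)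
    then show ?thesis using F_eq e_arr eD(1) by (auto simp: K_def)
  qed
  define X :: "('k, nat \<Rightarrow> 'k) fcomplex" where
    "X = \<lparr> fmod = (\<lambda>m. fun_vs),
       fsub = (\<lambda>p m. if m = n then F p else if m = n + 1 then K p else {\<lambda>_. 0}),
       fbd = (\<lambda>m x. if m = n + 1 then x else (\<lambda>_. 0)) \<rparr>"
  have X: "fmod X m = fun_vs" "fsub X p n = F p" "fsub X p (n + 1) = K p"
    "m \<noteq> n \<Longrightarrow> m \<noteq> n + 1 \<Longrightarrow> fsub X p m = {\<lambda>_. 0}"
    "fbd X m x = (if m = n + 1 then x else (\<lambda>_. 0))" for p m x
    by (simp_all add: X_def)
  have X_cases: "fsub X p m = F p \<or> fsub X p m = K p \<or> fsub X p m = {\<lambda>_. 0}" for p m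
    by (simp add: X_def)
  have fsub_sub: "vs_subspace fun_vs (fsub X p m)" for p m
    using X_cases[of p m] F_sub K_sub fun_vs.subspace_zero by auto
  have "fsub X p m \<subseteq> fun_upto (length (G p))" for p m
    using X_cases[of p m] by (auto simp: F_def K_def fun_upto_def)
  then have fsub_fd: "fin_dim (restr fun_vs (fsub X p m))" for p m
    using fun_vs.fin_dim_subspace[OF fsub_sub _ _ fin_dim_fun_upto] by (metis fun_vs_simps(1) top_greatest)
  have fbd_fsub: "fbd X m x \<in> fsub X p (m - 1)" if "x \<in> fsub X p m" for p m x
    using that fun_vs.subspaceD(3)[OF fsub_sub] by (auto simp: X K_def)
  have "is_fc X"
    unfolding is_fc_def lvl_def
  proof (intro conjI allI ballI)
    fix p m
    show "vs_linear (restr (fmod X m) (fsub X p m)) (restr (fmod X (m - 1)) (fsub X p (m - 1))) (fbd X m)"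
      using fbd_fsub by (auto simp: vs_linear_def X(1,5))
    show "fbd X (m - 1) (fbd X m x) = vzero (fmod X (m - 2))" for x
      by (simp add: X)
    show "fsub X p m \<subseteq> fsub X (p + 1) m"
      using F_mono K_mono by (simp add: X_def)
    \<comment> \<open>Only the boundary maps leaving degrees \<open>n + 2\<close>,
      \<open>n + 1\<close> and \<open>n\<close> touch a possibly nonzero space; all others map zero
      to zero.\<close>
    have "{m. \<not> bij_betw (fbd X m) (fsub X p m) (fsub X p (m - 1))} \<subseteq> {n, n + 1, n + 2}"
      by (auto simp: X bij_betw_def)
    then show "finite {m. \<not> bij_betw (fbd X m) (fsub X p m) (fsub X p (m - 1))}"
      by (rule finite_subset) simp
    show "\<exists>p0. \<forall>p\<le>p0. \<forall>m. fsub X p m = {vzero (fmod X m)}"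
      by (rule exI[of _ p0]) (simp add: X_def F0 K0)
    have "fsub X p = fsub X (p + 1)"
      if "bij_betw (parr W p) (vcarrier (?W p)) (vcarrier (?W (p + 1)))" for p
      using FK_stable[OF that] by (simp add: X_def fun_eq_iff)
    then have "{p. fsub X p \<noteq> fsub X (p + 1)} \<subseteq>
        {p. \<not> bij_betw (parr W p) (vcarrier (?W p)) (vcarrier (?W (p + 1)))}" by blast
    then show "finite {p. fsub X p \<noteq> fsub X (p + 1)}"
      using W finite_subset unfolding obj_imP_def obj_P_def tempered_def by blast
  qed (simp_all add: X(1) vs_axioms_fun_vs fsub_sub fsub_fd)
  then interpret X: filtered_complex X by unfold_locales
  \<comment> \<open>The boundary map is zero on degree \<open>n\<close> and the inclusion on degree
    \<open>n + 1\<close>, so the homology is \<open>F p / K p\<close>.\<close>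
  have cyc: "cycles X p n = F p" and bds: "boundaries X p n = K p" for p
    by (auto simp: cycles_def boundaries_def X)
  have "vs_quotient fun_vs (F p) (K p)" for p
    by unfold_locales ((rule F_sub K_sub)+, auto simp: K_def)
  then interpret Q: vs_quotient fun_vs "F p" "K p" for p .
  have "\<exists>g h. vs_linear (quot fun_vs (F p) (K p)) (?W p) g \<and> vs_linear (?W p) (quot fun_vs (F p) (K p)) h \<and>
      (\<forall>x\<in>F p. g (coset fun_vs (K p) x) = e p x) \<and> (\<forall>x\<in>F p. h (e p x) = coset fun_vs (K p) x)" for p
    using Q.first_isomorphism[OF W.vs_ax e_lin e_surj K_def] by metis
  then obtain g h where g_lin: "\<And>p. vs_linear (quot fun_vs (F p) (K p)) (?W p) (g p)"
    and h_lin: "\<And>p. vs_linear (?W p) (quot fun_vs (F p) (K p)) (h p)"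
    and g: "\<And>p x. x \<in> F p \<Longrightarrow> g p (coset fun_vs (K p) x) = e p x"
    and h: "\<And>p x. x \<in> F p \<Longrightarrow> h p (e p x) = coset fun_vs (K p) x"
    by metis
  have PX: "pspace (PH_obj n X) p = quot fun_vs (F p) (K p)" for p
    by (simp add: PH_obj_def homology_def cyc bds X(1))
  have PE: "\<exists>x\<in>F p. A = coset fun_vs (K p) x" if "A \<in> vcarrier (pspace (PH_obj n X) p)" for A p
    using X.PH_carrierE[OF that] unfolding cyc bds X(1) by blast
  have WE: "\<exists>x\<in>F p. w = e p x" if "w \<in> vcarrier (?W p)" for w p
    using that e_surj by blast
  have parr: "parr (PH_obj n X) p (coset fun_vs (K p) x) = coset fun_vs (K (p + 1)) x"
    if "x \<in> F p" for p x
    using X.PH_arr_coset[of x p n] that unfolding cyc bds X(1) by simp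
  have F_mono': "x \<in> F (p + 1)" if "x \<in> F p" for p x using that F_mono by blast
  have "pvs_mor (PH_obj n X) W g"
    unfolding pvs_mor_def
    by (auto simp: PX g_lin parr g e_arr F_mono' dest!: PE[unfolded PX])
  \<comment> \<open>Here \<open>e_arr\<close> is used from right to left: the arrow applied to
    \<open>e p x\<close> becomes \<open>e (p + 1) x\<close>, where the value of \<open>h\<close> is
    known.\<close>
  moreover have "pvs_mor W (PH_obj n X) h"
    unfolding pvs_mor_def
    by (auto simp: PX h_lin parr h F_mono' dest!: WE simp flip: e_arr)
  moreover have "pvs_mor_eq (PH_obj n X) (\<lambda>p x. h p (g p x)) (\<lambda>p x. x)"
    unfolding pvs_mor_eq_def by (auto simp: g h dest!: PE)
  moreover have "pvs_mor_eq W (\<lambda>p x. g p (h p x)) (\<lambda>p x. x)"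
    unfolding pvs_mor_eq_def by (auto simp: g h dest!: WE)
  ultimately have "pvs_iso (PH_obj n X) W" unfolding pvs_iso_def by blast
  with \<open>is_fc X\<close> show thesis by (rule that)
qed

text \<open>The equivalence is expressed as functoriality together with faithfulness, fullness and
  essential surjectivity, morphisms being compared only on carriers because HOL functions are total.
  Chain types are arbitrary in the full and faithful parts, so these can be instantiated at the type
  \<open>nat \<Rightarrow> 'k\<close> of the realizing complexes.\<close>

theorem theorem3p3:
  fixes n :: int
  shows
  "(\<forall>X :: ('k::field, 'v) fcomplex. is_fc X \<longrightarrow> obj_imP (PH_obj n X))
   \<and> (\<forall>(X :: ('k, 'v) fcomplex) (Y :: ('k, 'u) fcomplex) f.
        is_fc X \<and> is_fc Y \<and> fc_mor X Y f \<longrightarrow>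
        pvs_mor (PH_obj n X) (PH_obj n Y) (PH_mor n Y f))
   \<and> (\<forall>X :: ('k, 'v) fcomplex. is_fc X \<longrightarrow>
        pvs_mor_eq (PH_obj n X) (PH_mor n X (\<lambda>p m x. x)) (\<lambda>p A. A))
   \<and> (\<forall>(X :: ('k, 'v) fcomplex) (Y :: ('k, 'u) fcomplex) (Z :: ('k, 't) fcomplex) f g.
        is_fc X \<and> is_fc Y \<and> is_fc Z \<and> fc_mor X Y f \<and> fc_mor Y Z g \<longrightarrow>
        pvs_mor_eq (PH_obj n X) (PH_mor n Z (\<lambda>p m x. g p m (f p m x)))
                   (\<lambda>p A. PH_mor n Z g p (PH_mor n Y f p A)))
   \<and> (\<forall>(X :: ('k, 'v) fcomplex) (Y :: ('k, 'u) fcomplex) f f'.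
        is_fc X \<and> is_fc Y \<and> fc_mor X Y f \<and> fc_mor X Y f' \<longrightarrow>
        (coim_rel n X Y f f' \<longleftrightarrow>
         pvs_mor_eq (PH_obj n X) (PH_mor n Y f) (PH_mor n Y f')))
   \<and> (\<forall>(X :: ('k, 'v) fcomplex) (Y :: ('k, 'u) fcomplex) g.
        is_fc X \<and> is_fc Y \<and> pvs_mor (PH_obj n X) (PH_obj n Y) g \<longrightarrow>
        (\<exists>f. fc_mor X Y f \<and> pvs_mor_eq (PH_obj n X) (PH_mor n Y f) g))
   \<and> (\<forall>W :: ('k, 'w) pvs. obj_imP W \<longrightarrow>
        (\<exists>X :: ('k, nat \<Rightarrow> 'k) fcomplex. is_fc X \<and> pvs_iso (PH_obj n X) W))"
proof (intro conjI allI impI; (elim conjE)?)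
  show "obj_imP (PH_obj n X)" if "is_fc X" for X :: "('k, 'v) fcomplex"
    using that by (intro filtered_complex.obj_imP_PH filtered_complex.intro)
  show "pvs_mor_eq (PH_obj n X) (PH_mor n X (\<lambda>p m x. x)) (\<lambda>p A. A)"
    if "is_fc X" for X :: "('k, 'v) fcomplex"
    using that by (intro filtered_complex.PH_mor_id filtered_complex.intro)
  show "pvs_mor_eq (PH_obj n X) (PH_mor n Z (\<lambda>p m x. g p m (f p m x)))
      (\<lambda>p A. PH_mor n Z g p (PH_mor n Y f p A))"
    if "is_fc X" "is_fc Y" "is_fc Z" "fc_mor X Y f" "fc_mor Y Z g"
    for X :: "('k, 'v) fcomplex" and Y :: "('k, 'u) fcomplex" and Z :: "('k, 't) fcomplex" and f g
    using that by (rule PH_mor_comp)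
  show "\<exists>X :: ('k, nat \<Rightarrow> 'k) fcomplex. is_fc X \<and> pvs_iso (PH_obj n X) W"
    if "obj_imP W" for W :: "('k, 'w) pvs"
    using PH_essentially_surjective[OF that] by metis
  fix X :: "('k, 'v) fcomplex" and Y :: "('k, 'u) fcomplex"
  assume "is_fc X" "is_fc Y"
  then interpret filtered_complex_pair X Y by unfold_locales
  show "pvs_mor (PH_obj n X) (PH_obj n Y) (PH_mor n Y f)" if "fc_mor X Y f" for f
    using that by (rule pvs_mor_PH)
  show "\<exists>f. fc_mor X Y f \<and> pvs_mor_eq (PH_obj n X) (PH_mor n Y f) g"
    if "pvs_mor (PH_obj n X) (PH_obj n Y) g" for g
    using PH_full[OF that] by metis
\<comment> \<open>What remains is faithfulness: \<open>coim_rel\<close> is by definition equality of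
  the induced maps.\<close>
qed (simp add: coim_rel_def)

end
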